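(* Let $\mathcal{C}$ be an abelian rigid monoidal category and let $X$ be a Frobenius algebra in $\mathcal{C}$ which is of finite length as an object. A subposet of the Frobenius subalgebra poset of $X$ can be extended to a sublattice with meet given by intersection, $[A]\wedge[B]=[A\cap B]$, if and only if the intersection $A\cap B$ of any two class representatives $A,B$ (of elements of the subposet) is an ambiently selfdual subobject of $X$.
   Context: Monoidal categories are taken strict. A left dual of $X$ is a triple $(X^*,\mathrm{ev}_X:X^*\otimes X\to\mathbf 1,\mathrm{coev}_X:\mathbf 1\to X\otimes X^* )$ satisfying the zigzag identities; for $f:X\to Y$, $f^*:Y^*\to X^*$ is the dual morphism $(\mathrm{ev}_Y\otimes \mathrm{id})\circ(\mathrm{id}\otimes f\otimes \mathrm{id})\circ(\mathrm{id}\otimes\mathrm{coev}_X)$. A Frobenius algebra is $(X,m,\delta,e,\epsilon)$ with $(X,m,e)$ a unital algebra, $(X,\delta,\epsilon)$ a counital coalgebra and $(\mathrm{id}_X\otimes m)\circ(\delta\otimes \mathrm{id}_X)=\delta\circ m=(m\otimes \mathrm{id}_X)\circ(\mathrm{id}_X\otimes\delta)$. It is always regarded as selfdual, $X^*=X$, with $\mathrm{ev}_X=\epsilon\circ m$ and $\mathrm{coev}_X=\delta\circ e$. A Frobenius algebra $X'$ is a Frobenius subalgebra of $X$ if there is a unital algebra monomorphism $i:X'\to X$ with $i^{**}=i$ and $i^*\circ i=\mathrm{id}_{X'}$; put $b_{X'}:=i\circ i^*\in\mathrm{End}_{\mathcal C}(X)$, an idempotent. Two Frobenius subalgebras $X_1,X_2$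 (with monomorphisms $i_1,i_2$) are equivalent if there is an isomorphism $i_{1,2}:X_1\to X_2$ with inverse $i_{2,1}$ such that $i_1=i_2\circ i_{1,2}$ and $i_1^*=i_{2,1}\circ i_2^*$ (equivalently $b_{X_1}=b_{X_2}$). The class of $X_1$ is $[X_1]$. The Frobenius subalgebra poset of $X$ is the set of equivalence classes with $[X_1]\le[X_2]$ iff $b_{X_1}\circ b_{X_2}=b_{X_1}=b_{X_2}\circ b_{X_1}$. "Sublattice" means a subposet of this poset which is itself a lattice for the induced order. Ambient selfduality: let $C$ be selfdual ($C^*=C$) and let $(B,i,p)$ be a split subobject of $C$ ($i:B\to C$, $p:C\to B$, $p\circ i=\mathrm{id}_B$), with $b=i\circ p$. Split $b^*\in \mathrm{End}(C^* )$ as $b^*=i'\circ p'$, $p'\circ i'=\mathrm{id}_{B'}$; the ambient dual of $B$ is $(B',\mathrm{ev}_C\circ(i'\otimes i),(p\otimes p')\circ\mathrm{coev}_C)$ (for this dual, $i^*=p'$ and $p^*=i'$). $(B,i,p)$ is ambiently selfdual if it coincides with its ambient dual, i.e. one may take $B'=B$, $i'=i$, $p'=p$; in that case $i^*=p$ and $i^{**}=p^*=i$. A subobject is called ambiently selfdual if this holds for some retraction $p$. $A\cap B$ is the intersection (pullback of the monomorphisms) of $A,B$ as subobjects of $X$.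
   Formalization: The selfduality condition is required for class representatives of all elements obtained from the subposet by adjoining iterated intersections that are Frobenius subalgebras, not only for elements of the subposet itself; with the latter the "if" direction is false. *)

theory Defs
  imports "HOL-Algebra.Lattice"
begin

text \<open>Objects and morphisms have separate types; \<open>\<odot>\<close> is the tensor product of objects,
  \<open>\<otimes>\<close> that of morphisms, and composition is written in the usual order, \<open>g \<cdot> f\<close>
  meaning first \<open>f\<close>.\<close>

record ('o, 'm) moncat =
  Ob :: "'o set"
  Ar :: "'m set"
  Src :: "'m \<Rightarrow> 'o"
  Tgt :: "'m \<Rightarrow> 'o"
  Ident :: "'o \<Rightarrow> 'm" (\<open>\<i>\<d>\<index>\<close>)
  Comp :: "'m \<Rightarrow> 'm \<Rightarrow> 'm" (infixl \<open>\<cdot>\<index>\<close> 60)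
  TensO :: "'o \<Rightarrow> 'o \<Rightarrow> 'o" (infixl \<open>\<odot>\<index>\<close> 75)
  TensA :: "'m \<Rightarrow> 'm \<Rightarrow> 'm" (infixl \<open>\<otimes>\<index>\<close> 75)
  Unit :: "'o" (\<open>\<one>\<index>\<close>)

definition hom :: "('o, 'm, 'x) moncat_scheme \<Rightarrow> 'o \<Rightarrow> 'o \<Rightarrow> 'm set" where
  "hom C A B = {f \<in> Ar C. Src C f = A \<and> Tgt C f = B}"

locale category =
  fixes C :: "('o, 'm, 'x) moncat_scheme" (structure)
  assumes src: "f \<in> Ar C \<Longrightarrow> Src C f \<in> Ob C"
    and tgt: "f \<in> Ar C \<Longrightarrow> Tgt C f \<in> Ob C"
    and ident: "A \<in> Ob C \<Longrightarrow> \<i>\<d> A \<in> hom C A A"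
    and comp: "\<lbrakk>f \<in> hom C A B; g \<in> hom C B D\<rbrakk> \<Longrightarrow> g \<cdot> f \<in> hom C A D"
    and comp_ident: "f \<in> hom C A B \<Longrightarrow> f \<cdot> \<i>\<d> A = f"
    and ident_comp: "f \<in> hom C A B \<Longrightarrow> \<i>\<d> B \<cdot> f = f"
    and comp_assoc:
      "\<lbrakk>f \<in> hom C A B; g \<in> hom C B D; h \<in> hom C D E\<rbrakk> \<Longrightarrow> (h \<cdot> g) \<cdot> f = h \<cdot> (g \<cdot> f)"

locale strict_monoidal_category = category +
  assumes unit: "\<one> \<in> Ob C"
    and tensO: "\<lbrakk>A \<in> Ob C; B \<in> Ob C\<rbrakk> \<Longrightarrow> A \<odot> B \<in> Ob C"
    and tensO_assoc:
      "\<lbrakk>A \<in> Ob C; B \<in> Ob C; D \<in> Ob C\<rbrakk> \<Longrightarrow> (A \<odot> B) \<odot> D = A \<odot> (B \<odot> D)"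
    and unit_tensO: "A \<in> Ob C \<Longrightarrow> \<one> \<odot> A = A"
    and tensO_unit: "A \<in> Ob C \<Longrightarrow> A \<odot> \<one> = A"
    and tensA: "\<lbrakk>f \<in> hom C A A'; g \<in> hom C B B'\<rbrakk> \<Longrightarrow> f \<otimes> g \<in> hom C (A \<odot> B) (A' \<odot> B')"
    and tensA_ident: "\<lbrakk>A \<in> Ob C; B \<in> Ob C\<rbrakk> \<Longrightarrow> \<i>\<d> A \<otimes> \<i>\<d> B = \<i>\<d> (A \<odot> B)"
    and tensA_comp:
      "\<lbrakk>f \<in> hom C A A'; f' \<in> hom C A' A''; g \<in> hom C B B'; g' \<in> hom C B' B''\<rbrakk>
       \<Longrightarrow> (f' \<cdot> f) \<otimes> (g' \<cdot> g) = (f' \<otimes> g') \<cdot> (f \<otimes> g)"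
    and tensA_assoc:
      "\<lbrakk>f \<in> Ar C; g \<in> Ar C; h \<in> Ar C\<rbrakk> \<Longrightarrow> (f \<otimes> g) \<otimes> h = f \<otimes> (g \<otimes> h)"
    and unit_tensA: "f \<in> Ar C \<Longrightarrow> \<i>\<d> \<one> \<otimes> f = f"
    and tensA_unit: "f \<in> Ar C \<Longrightarrow> f \<otimes> \<i>\<d> \<one> = f"


section \<open>Abelian categories\<close>

definition mono :: "('o, 'm, 'x) moncat_scheme \<Rightarrow> 'm \<Rightarrow> bool" where
  "mono C f \<longleftrightarrow> f \<in> Ar C \<and>
     (\<forall>A. \<forall>g\<in>hom C A (Src C f). \<forall>h\<in>hom C A (Src C f). f \<cdot>\<^bsub>C\<^esub> g = f \<cdot>\<^bsub>C\<^esub> h \<longrightarrow> g = h)"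

definition epi :: "('o, 'm, 'x) moncat_scheme \<Rightarrow> 'm \<Rightarrow> bool" where
  "epi C f \<longleftrightarrow> f \<in> Ar C \<and>
     (\<forall>A. \<forall>g\<in>hom C (Tgt C f) A. \<forall>h\<in>hom C (Tgt C f) A. g \<cdot>\<^bsub>C\<^esub> f = h \<cdot>\<^bsub>C\<^esub> f \<longrightarrow> g = h)"

definition inverse_pair :: "('o, 'm, 'x) moncat_scheme \<Rightarrow> 'o \<Rightarrow> 'o \<Rightarrow> 'm \<Rightarrow> 'm \<Rightarrow> bool" where
  "inverse_pair C A B f g \<longleftrightarrow> f \<in> hom C A B \<and> g \<in> hom C B A \<and>
     g \<cdot>\<^bsub>C\<^esub> f = Ident C A \<and> f \<cdot>\<^bsub>C\<^esub> g = Ident C B"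

definition zero_object :: "('o, 'm, 'x) moncat_scheme \<Rightarrow> 'o \<Rightarrow> bool" where
  "zero_object C Z \<longleftrightarrow> Z \<in> Ob C \<and>
     (\<forall>A\<in>Ob C. (\<exists>!f. f \<in> hom C A Z) \<and> (\<exists>!f. f \<in> hom C Z A))"

definition zero_mor :: "('o, 'm, 'x) moncat_scheme \<Rightarrow> 'o \<Rightarrow> 'o \<Rightarrow> 'm \<Rightarrow> bool" where
  "zero_mor C A B f \<longleftrightarrow>
     (\<exists>Z g h. zero_object C Z \<and> g \<in> hom C A Z \<and> h \<in> hom C Z B \<and> f = h \<cdot>\<^bsub>C\<^esub> g)"

definition is_kernel :: "('o, 'm, 'x) moncat_scheme \<Rightarrow> 'o \<Rightarrow> 'm \<Rightarrow> 'm \<Rightarrow> bool" where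
  "is_kernel C K k f \<longleftrightarrow> f \<in> Ar C \<and> k \<in> hom C K (Src C f) \<and> zero_mor C K (Tgt C f) (f \<cdot>\<^bsub>C\<^esub> k) \<and>
     (\<forall>A. \<forall>g\<in>hom C A (Src C f). zero_mor C A (Tgt C f) (f \<cdot>\<^bsub>C\<^esub> g) \<longrightarrow>
        (\<exists>!u. u \<in> hom C A K \<and> k \<cdot>\<^bsub>C\<^esub> u = g))"

definition is_cokernel :: "('o, 'm, 'x) moncat_scheme \<Rightarrow> 'o \<Rightarrow> 'm \<Rightarrow> 'm \<Rightarrow> bool" where
  "is_cokernel C Q q f \<longleftrightarrow> f \<in> Ar C \<and> q \<in> hom C (Tgt C f) Q \<and> zero_mor C (Src C f) Q (q \<cdot>\<^bsub>C\<^esub> f) \<and>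
     (\<forall>A. \<forall>g\<in>hom C (Tgt C f) A. zero_mor C (Src C f) A (g \<cdot>\<^bsub>C\<^esub> f) \<longrightarrow>
        (\<exists>!u. u \<in> hom C Q A \<and> u \<cdot>\<^bsub>C\<^esub> q = g))"

definition is_product :: "('o, 'm, 'x) moncat_scheme \<Rightarrow> 'o \<Rightarrow> 'o \<Rightarrow> 'o \<Rightarrow> 'm \<Rightarrow> 'm \<Rightarrow> bool" where
  "is_product C A B P p q \<longleftrightarrow> P \<in> Ob C \<and> p \<in> hom C P A \<and> q \<in> hom C P B \<and>
     (\<forall>T. \<forall>f\<in>hom C T A. \<forall>g\<in>hom C T B.
        \<exists>!u. u \<in> hom C T P \<and> p \<cdot>\<^bsub>C\<^esub> u = f \<and> q \<cdot>\<^bsub>C\<^esub> u = g)"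

definition is_coproduct :: "('o, 'm, 'x) moncat_scheme \<Rightarrow> 'o \<Rightarrow> 'o \<Rightarrow> 'o \<Rightarrow> 'm \<Rightarrow> 'm \<Rightarrow> bool" where
  "is_coproduct C A B P i j \<longleftrightarrow> P \<in> Ob C \<and> i \<in> hom C A P \<and> j \<in> hom C B P \<and>
     (\<forall>T. \<forall>f\<in>hom C A T. \<forall>g\<in>hom C B T.
        \<exists>!u. u \<in> hom C P T \<and> u \<cdot>\<^bsub>C\<^esub> i = f \<and> u \<cdot>\<^bsub>C\<^esub> j = g)"

text \<open>This is Freyd's definition of an abelian category; the addition of parallel morphisms is
  determined by these axioms and is not carried as data. (In the rigid monoidal case the tensor
  product is then automatically biadditive, since \<open>A \<odot> -\<close> and \<open>- \<odot> A\<close> have adjoints on both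
  sides.)\<close>

locale abelian_category = category +
  assumes has_zero: "\<exists>Z. zero_object C Z"
    and has_products: "\<lbrakk>A \<in> Ob C; B \<in> Ob C\<rbrakk> \<Longrightarrow> \<exists>P p q. is_product C A B P p q"
    and has_coproducts: "\<lbrakk>A \<in> Ob C; B \<in> Ob C\<rbrakk> \<Longrightarrow> \<exists>P i j. is_coproduct C A B P i j"
    and has_kernels: "f \<in> Ar C \<Longrightarrow> \<exists>K k. is_kernel C K k f"
    and has_cokernels: "f \<in> Ar C \<Longrightarrow> \<exists>Q q. is_cokernel C Q q f"
    and mono_normal: "mono C f \<Longrightarrow> \<exists>g. is_kernel C (Src C f) f g"
    and epi_normal: "epi C f \<Longrightarrow> \<exists>g. is_cokernel C (Tgt C f) f g"

definition simple_object :: "('o, 'm, 'x) moncat_scheme \<Rightarrow> 'o \<Rightarrow> bool" where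
  "simple_object C S \<longleftrightarrow> S \<in> Ob C \<and> \<not> zero_object C S \<and>
     (\<forall>A. \<forall>f\<in>hom C A S. mono C f \<longrightarrow> zero_object C A \<or> (\<exists>g. inverse_pair C A S f g))"

text \<open>Existence of a filtration \<open>0 = Y 0 \<subseteq> \<dots> \<subseteq> Y n = X\<close> with simple quotients.\<close>

definition finite_length :: "('o, 'm, 'x) moncat_scheme \<Rightarrow> 'o \<Rightarrow> bool" where
  "finite_length C X \<longleftrightarrow>
     (\<exists>(n::nat) Y u. zero_object C (Y 0) \<and> Y n = X \<and>
        (\<forall>k<n. u k \<in> hom C (Y k) (Y (Suc k)) \<and> mono C (u k) \<and>
               (\<exists>S q. is_cokernel C S q (u k) \<and> simple_object C S)))"

text \<open>\<open>(D, j)\<close> is the subobject of the common target of \<open>a\<close> and \<open>b\<close> given by their pullback.\<close>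

definition is_intersection ::
    "('o, 'm, 'x) moncat_scheme \<Rightarrow> 'o \<Rightarrow> 'm \<Rightarrow> 'm \<Rightarrow> 'm \<Rightarrow> bool" where
  "is_intersection C D j a b \<longleftrightarrow>
     (\<exists>f\<in>hom C D (Src C a). \<exists>g\<in>hom C D (Src C b). D \<in> Ob C \<and>
        a \<cdot>\<^bsub>C\<^esub> f = b \<cdot>\<^bsub>C\<^esub> g \<and> j = a \<cdot>\<^bsub>C\<^esub> f \<and>
        (\<forall>T. \<forall>s\<in>hom C T (Src C a). \<forall>t\<in>hom C T (Src C b). a \<cdot>\<^bsub>C\<^esub> s = b \<cdot>\<^bsub>C\<^esub> t \<longrightarrow>
           (\<exists>!u. u \<in> hom C T D \<and> f \<cdot>\<^bsub>C\<^esub> u = s \<and> g \<cdot>\<^bsub>C\<^esub> u = t)))"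


section \<open>Duality\<close>

text \<open>\<open>(Y, ev, coev)\<close> is a left dual of \<open>X\<close>; equivalently \<open>X\<close> is a right dual of \<open>Y\<close>.\<close>

definition is_left_dual ::
    "('o, 'm, 'x) moncat_scheme \<Rightarrow> 'o \<Rightarrow> 'o \<Rightarrow> 'm \<Rightarrow> 'm \<Rightarrow> bool" where
  "is_left_dual C X Y ev coev \<longleftrightarrow> X \<in> Ob C \<and> Y \<in> Ob C \<and>
     ev \<in> hom C (Y \<odot>\<^bsub>C\<^esub> X) (Unit C) \<and> coev \<in> hom C (Unit C) (X \<odot>\<^bsub>C\<^esub> Y) \<and>
     (Ident C X \<otimes>\<^bsub>C\<^esub> ev) \<cdot>\<^bsub>C\<^esub> (coev \<otimes>\<^bsub>C\<^esub> Ident C X) = Ident C X \<and>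
     (ev \<otimes>\<^bsub>C\<^esub> Ident C Y) \<cdot>\<^bsub>C\<^esub> (Ident C Y \<otimes>\<^bsub>C\<^esub> coev) = Ident C Y"

locale abelian_rigid_monoidal_category = strict_monoidal_category + abelian_category +
  assumes has_left_dual: "X \<in> Ob C \<Longrightarrow> \<exists>Y ev coev. is_left_dual C X Y ev coev"
    and has_right_dual: "X \<in> Ob C \<Longrightarrow> \<exists>Y ev coev. is_left_dual C Y X ev coev"

text \<open>The dual \<open>f\<^sup>* : Y\<^sup>* \<rightarrow> X\<^sup>*\<close> of \<open>f : X \<rightarrow> Y\<close>, where \<open>Xs = X\<^sup>*\<close> comes with \<open>coevX\<close> and
  \<open>Ys = Y\<^sup>*\<close> with \<open>evY\<close>.\<close>

definition dual_mor ::
    "('o, 'm, 'x) moncat_scheme \<Rightarrow> 'o \<Rightarrow> 'm \<Rightarrow> 'o \<Rightarrow> 'm \<Rightarrow> 'm \<Rightarrow> 'm" where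
  "dual_mor C Xs coevX Ys evY f =
     (evY \<otimes>\<^bsub>C\<^esub> Ident C Xs) \<cdot>\<^bsub>C\<^esub> (Ident C Ys \<otimes>\<^bsub>C\<^esub> f \<otimes>\<^bsub>C\<^esub> Ident C Xs) \<cdot>\<^bsub>C\<^esub> (Ident C Ys \<otimes>\<^bsub>C\<^esub> coevX)"

definition split_subobject ::
    "('o, 'm, 'x) moncat_scheme \<Rightarrow> 'o \<Rightarrow> 'o \<Rightarrow> 'm \<Rightarrow> 'm \<Rightarrow> bool" where
  "split_subobject C X B i p \<longleftrightarrow>
     B \<in> Ob C \<and> i \<in> hom C B X \<and> p \<in> hom C X B \<and> p \<cdot>\<^bsub>C\<^esub> i = Ident C B"

text \<open>Let \<open>(X, ev, coev)\<close> be selfdual. \<open>(B', i', p')\<close> splits \<open>b\<^sup>*\<close>, where \<open>b = i \<cdot> p\<close> is the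
  idempotent of the split subobject \<open>(B, i, p)\<close>; thus \<open>B'\<close>, with the evaluation and coevaluation
  \<open>ev \<cdot> (i' \<otimes> i)\<close> and \<open>(p \<otimes> p') \<cdot> coev\<close>, is the ambient dual of \<open>B\<close>.\<close>

definition is_ambient_dual ::
    "('o, 'm, 'x) moncat_scheme \<Rightarrow> 'o \<Rightarrow> 'm \<Rightarrow> 'm \<Rightarrow> 'o \<times> 'm \<times> 'm \<Rightarrow> 'o \<times> 'm \<times> 'm \<Rightarrow> bool" where
  "is_ambient_dual C X ev coev = (\<lambda>(B, i, p) (B', i', p').
     split_subobject C X B i p \<and> split_subobject C X B' i' p' \<and>
     dual_mor C X coev X ev (i \<cdot>\<^bsub>C\<^esub> p) = i' \<cdot>\<^bsub>C\<^esub> p')"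

definition ambiently_selfdual ::
    "('o, 'm, 'x) moncat_scheme \<Rightarrow> 'o \<Rightarrow> 'm \<Rightarrow> 'm \<Rightarrow> 'o \<Rightarrow> 'm \<Rightarrow> bool" where
  "ambiently_selfdual C X ev coev B i \<longleftrightarrow>
     (\<exists>p. is_ambient_dual C X ev coev (B, i, p) (B, i, p))"


section \<open>Frobenius algebras and Frobenius subalgebras\<close>

record ('o, 'm) frob =
  fob :: "'o"
  fmult :: "'m"
  fcomult :: "'m"
  funit :: "'m"
  fcounit :: "'m"

locale frobenius_algebra = strict_monoidal_category +
  fixes F :: "('o, 'm) frob"
  assumes fob: "fob F \<in> Ob C"
    and fmult: "fmult F \<in> hom C (fob F \<odot> fob F) (fob F)"
    and fcomult: "fcomult F \<in> hom C (fob F) (fob F \<odot> fob F)"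
    and funit: "funit F \<in> hom C \<one> (fob F)"
    and fcounit: "fcounit F \<in> hom C (fob F) \<one>"
    and fmult_assoc: "fmult F \<cdot> (fmult F \<otimes> \<i>\<d> (fob F)) = fmult F \<cdot> (\<i>\<d> (fob F) \<otimes> fmult F)"
    and funit_left: "fmult F \<cdot> (funit F \<otimes> \<i>\<d> (fob F)) = \<i>\<d> (fob F)"
    and funit_right: "fmult F \<cdot> (\<i>\<d> (fob F) \<otimes> funit F) = \<i>\<d> (fob F)"
    and fcomult_coassoc:
      "(fcomult F \<otimes> \<i>\<d> (fob F)) \<cdot> fcomult F = (\<i>\<d> (fob F) \<otimes> fcomult F) \<cdot> fcomult F"
    and fcounit_left: "(fcounit F \<otimes> \<i>\<d> (fob F)) \<cdot> fcomult F = \<i>\<d> (fob F)"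
    and fcounit_right: "(\<i>\<d> (fob F) \<otimes> fcounit F) \<cdot> fcomult F = \<i>\<d> (fob F)"
    and frobenius_left:
      "(\<i>\<d> (fob F) \<otimes> fmult F) \<cdot> (fcomult F \<otimes> \<i>\<d> (fob F)) = fcomult F \<cdot> fmult F"
    and frobenius_right:
      "(fmult F \<otimes> \<i>\<d> (fob F)) \<cdot> (\<i>\<d> (fob F) \<otimes> fcomult F) = fcomult F \<cdot> fmult F"

definition fev :: "('o, 'm, 'x) moncat_scheme \<Rightarrow> ('o, 'm) frob \<Rightarrow> 'm" where
  "fev C F = fcounit F \<cdot>\<^bsub>C\<^esub> fmult F"

definition fcoev :: "('o, 'm, 'x) moncat_scheme \<Rightarrow> ('o, 'm) frob \<Rightarrow> 'm" where
  "fcoev C F = fcomult F \<cdot>\<^bsub>C\<^esub> funit F"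

text \<open>The dual \<open>f\<^sup>* : G \<rightarrow> F\<close> of \<open>f : F \<rightarrow> G\<close> for Frobenius algebras \<open>F\<close>, \<open>G\<close>, both regarded as
  selfdual objects.\<close>

definition fdual ::
    "('o, 'm, 'x) moncat_scheme \<Rightarrow> ('o, 'm) frob \<Rightarrow> ('o, 'm) frob \<Rightarrow> 'm \<Rightarrow> 'm" where
  "fdual C F G f = dual_mor C (fob F) (fcoev C F) (fob G) (fev C G) f"

text \<open>A Frobenius subalgebra is given together with its monomorphism.\<close>

definition frob_subalgebras ::
    "('o, 'm, 'x) moncat_scheme \<Rightarrow> ('o, 'm) frob \<Rightarrow> (('o, 'm) frob \<times> 'm) set" where
  "frob_subalgebras C X = {(F, i). frobenius_algebra C F \<and> i \<in> hom C (fob F) (fob X) \<and> mono C i \<and>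
     i \<cdot>\<^bsub>C\<^esub> fmult F = fmult X \<cdot>\<^bsub>C\<^esub> (i \<otimes>\<^bsub>C\<^esub> i) \<and> i \<cdot>\<^bsub>C\<^esub> funit F = funit X \<and>
     fdual C X F (fdual C F X i) = i \<and>
     fdual C F X i \<cdot>\<^bsub>C\<^esub> i = Ident C (fob F)}"

definition bproj ::
    "('o, 'm, 'x) moncat_scheme \<Rightarrow> ('o, 'm) frob \<Rightarrow> ('o, 'm) frob \<times> 'm \<Rightarrow> 'm" where
  "bproj C X = (\<lambda>(F, i). i \<cdot>\<^bsub>C\<^esub> fdual C F X i)"

definition frob_equiv ::
    "('o, 'm, 'x) moncat_scheme \<Rightarrow> ('o, 'm) frob \<Rightarrow>
     ((('o, 'm) frob \<times> 'm) \<times> (('o, 'm) frob \<times> 'm)) set" where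
  "frob_equiv C X = {((F1, i1), (F2, i2)).
     (F1, i1) \<in> frob_subalgebras C X \<and> (F2, i2) \<in> frob_subalgebras C X \<and>
     (\<exists>i12 i21. inverse_pair C (fob F1) (fob F2) i12 i21 \<and>
        i1 = i2 \<cdot>\<^bsub>C\<^esub> i12 \<and> fdual C F1 X i1 = i21 \<cdot>\<^bsub>C\<^esub> fdual C F2 X i2)}"

abbreviation frob_class ::
    "('o, 'm, 'x) moncat_scheme \<Rightarrow> ('o, 'm) frob \<Rightarrow> ('o, 'm) frob \<times> 'm \<Rightarrow>
     (('o, 'm) frob \<times> 'm) set" where
  "frob_class C X A \<equiv> frob_equiv C X `` {A}"

definition frob_classes ::
    "('o, 'm, 'x) moncat_scheme \<Rightarrow> ('o, 'm) frob \<Rightarrow> (('o, 'm) frob \<times> 'm) set set" where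
  "frob_classes C X = frob_subalgebras C X // frob_equiv C X"

definition frob_le ::
    "('o, 'm, 'x) moncat_scheme \<Rightarrow> ('o, 'm) frob \<Rightarrow>
     (('o, 'm) frob \<times> 'm) set \<Rightarrow> (('o, 'm) frob \<times> 'm) set \<Rightarrow> bool" where
  "frob_le C X \<alpha> \<beta> \<longleftrightarrow> (\<exists>A\<in>\<alpha>. \<exists>B\<in>\<beta>.
     bproj C X A \<cdot>\<^bsub>C\<^esub> bproj C X B = bproj C X A \<and> bproj C X B \<cdot>\<^bsub>C\<^esub> bproj C X A = bproj C X A)"

text \<open>The subposet of the Frobenius subalgebra poset on a set \<open>P\<close> of classes, with the induced
  order.\<close>

definition frob_subposet ::
    "('o, 'm, 'x) moncat_scheme \<Rightarrow> ('o, 'm) frob \<Rightarrow> (('o, 'm) frob \<times> 'm) set set \<Rightarrow>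
     (('o, 'm) frob \<times> 'm) set gorder" where
  "frob_subposet C X P = \<lparr>carrier = P, eq = (=), le = frob_le C X\<rparr>"

abbreviation frob_intersection ::
    "('o, 'm, 'x) moncat_scheme \<Rightarrow> 'o \<Rightarrow> 'm \<Rightarrow> ('o, 'm) frob \<times> 'm \<Rightarrow> ('o, 'm) frob \<times> 'm \<Rightarrow> bool" where
  "frob_intersection C D j A B \<equiv> is_intersection C D j (snd A) (snd B)"

text \<open>The lattice condition on a set \<open>L\<close> of classes, with \<open>[A] \<and> [B] = [A \<inter> B]\<close>. The equation
  includes that \<open>A \<inter> B\<close> underlies a Frobenius subalgebra \<open>F\<close>; the class of \<open>F\<close> is determined by
  the subobject \<open>A \<inter> B\<close> alone, as two idempotents \<open>b = b\<^sup>*\<close> with the same image are equal.\<close>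

definition intersection_sublattice ::
    "('o, 'm, 'x) moncat_scheme \<Rightarrow> ('o, 'm) frob \<Rightarrow> (('o, 'm) frob \<times> 'm) set set \<Rightarrow> bool" where
  "intersection_sublattice C X L \<longleftrightarrow> L \<subseteq> frob_classes C X \<and> lattice (frob_subposet C X L) \<and>
     (\<forall>\<alpha>\<in>L. \<forall>\<beta>\<in>L. \<forall>A\<in>\<alpha>. \<forall>B\<in>\<beta>. \<exists>F\<in>frob_subalgebras C X.
        frob_intersection C (fob (fst F)) (snd F) A B \<and>
        meet (frob_subposet C X L) \<alpha> \<beta> = frob_class C X F)"

text \<open>The closure of \<open>P\<close> under those intersections that are Frobenius subalgebras. Ambient
  selfduality of \<open>A \<inter> B\<close> for \<open>A\<close>, \<open>B\<close> in \<open>P\<close> only does not suffice for an extension of \<open>P\<close>: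
  in \<open>k[x, y, z]/(x\<^sup>2, y\<^sup>2, z\<^sup>2)\<close>, with a counit that is \<open>0\<close> on \<open>1\<close> and \<open>1\<close> on all other square-free
  monomials, the Frobenius subalgebras generated by two of the variables intersect pairwise in the
  ambiently selfdual \<open>k[x]\<close>, \<open>k[y]\<close>, \<open>k[z]\<close>, but no Frobenius subalgebra is contained
  in both \<open>k[x]\<close> and \<open>k[y]\<close>.\<close>

inductive_set intersection_closure ::
    "('o, 'm, 'x) moncat_scheme \<Rightarrow> ('o, 'm) frob \<Rightarrow> (('o, 'm) frob \<times> 'm) set set \<Rightarrow>
     (('o, 'm) frob \<times> 'm) set set"
  for C :: "('o, 'm, 'x) moncat_scheme" and X :: "('o, 'm) frob"
    and P :: "(('o, 'm) frob \<times> 'm) set set" where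
  base: "\<alpha> \<in> P \<Longrightarrow> \<alpha> \<in> intersection_closure C X P"
| step: "\<lbrakk>\<alpha> \<in> intersection_closure C X P; \<beta> \<in> intersection_closure C X P; A \<in> \<alpha>; B \<in> \<beta>;
    F \<in> frob_subalgebras C X; frob_intersection C (fob (fst F)) (snd F) A B\<rbrakk>
    \<Longrightarrow> frob_class C X F \<in> intersection_closure C X P"

lemma intersection_closure_eq:
  assumes "\<And>\<alpha> \<beta> A B F. \<lbrakk>\<alpha> \<in> P; \<beta> \<in> P; A \<in> \<alpha>; B \<in> \<beta>; F \<in> frob_subalgebras C X;
      frob_intersection C (fob (fst F)) (snd F) A B\<rbrakk> \<Longrightarrow> frob_class C X F \<in> P"
  shows "intersection_closure C X P = P"
proof
  show "intersection_closure C X P \<subseteq> P"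
  proof
    fix \<alpha> assume "\<alpha> \<in> intersection_closure C X P"
    then show "\<alpha> \<in> P"
      by induction (use assms in blast)+
  qed
qed (auto intro: intersection_closure.base)

end

theory Submission
  imports Defs
begin

text \<open>The proof rests on the idempotent \<open>b = i i\<^sup>*\<close> of a Frobenius subalgebra \<open>i : F \<rightarrow> X\<close>. It determines
  the class of \<open>F\<close>, and it is selfdual, \<open>b\<^sup>* = b\<close>, because \<open>i\<^sup>*\<^sup>* = i\<close>. Dualizing \<open>b b' = b\<close> for two such
  idempotents gives \<open>b' b = b\<close>, so either of the two equations that define the order already says
  that one subobject is contained in the other (\<open>sub_le_iff\<close>, \<open>frob_le_class\<close>). The order of classes
  is therefore inclusion of subobjects, and an intersection \<open>A \<inter> B\<close> that carries a Frobenius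
  subalgebra represents the meet of \<open>[A]\<close> and \<open>[B]\<close> in every set of classes that contains
  all three (\<open>intersection_greatest\<close>).

  If \<open>P\<close> lies in a sublattice whose meets are intersections, then so does its closure under
  intersections, and the intersection of any two members of the closure is isomorphic, as a
  subobject, to a Frobenius subalgebra. The selfdual idempotent of the latter witnesses ambient
  selfduality (\<open>frobenius_intersection_selfdual\<close>).

  Conversely, an intersection \<open>j : D \<rightarrow> X\<close> of Frobenius subalgebras is closed under multiplication and
  contains the unit. If it is ambiently selfdual, with retraction \<open>p\<close> and \<open>b = j p\<close>, then
  \<open>ev (b \<otimes> id) = ev (id \<otimes> b)\<close>, and this makes the restriction of the form \<open>\<epsilon> m\<close> to \<open>D\<close> nondegenerate, with
  coevaluation \<open>(p \<otimes> p) coev\<close>. An algebra with such a form is a Frobenius algebra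
  (\<open>frobenius_algebra_of_nondegenerate_form\<close>), and with respect to this structure \<open>j\<^sup>* = p\<close> and
  \<open>p\<^sup>* = j\<close>, so that \<open>D\<close> is a Frobenius subalgebra (\<open>selfdual_subalgebra_frobenius\<close>). Hence the closure
  of \<open>P\<close>, with \<open>[X]\<close> added as a top element, has all binary meets, given by intersections.

  Binary joins come from finite length. A strict inclusion of subobjects strictly increases the
  number of layers of the filtration of \<open>X\<close> that the subobject meets
  (\<open>finite_length_strict_rank\<close>); an upper bound of two classes with the fewest layers is below
  every other upper bound, since its meet with the other one is again an upper bound
  (\<open>lattice_of_ranked_meets\<close>).\<close>

section \<open>Monomorphisms and intersections in a category\<close>

context category
begin

text \<open>The axioms restated with \<^const>\<open>Ar\<close>, \<^const>\<open>Src\<close> and \<^const>\<open>Tgt\<close> in place of \<^const>\<open>hom\<close>: their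
  premises are then equations between objects, which the simplifier decides by normalizing tensor
  products.\<close>
lemma Ar_comp: "\<lbrakk>f \<in> Ar C; g \<in> Ar C; Tgt C f = Src C g\<rbrakk> \<Longrightarrow> g \<cdot> f \<in> Ar C"
  and Src_comp: "\<lbrakk>f \<in> Ar C; g \<in> Ar C; Tgt C f = Src C g\<rbrakk> \<Longrightarrow> Src C (g \<cdot> f) = Src C f"
  and Tgt_comp: "\<lbrakk>f \<in> Ar C; g \<in> Ar C; Tgt C f = Src C g\<rbrakk> \<Longrightarrow> Tgt C (g \<cdot> f) = Tgt C g"
  using comp[of f "Src C f" "Tgt C f" g "Tgt C g"] by (auto simp: hom_def)

lemma Ar_ident: "A \<in> Ob C \<Longrightarrow> \<i>\<d> A \<in> Ar C"
  and Src_ident: "A \<in> Ob C \<Longrightarrow> Src C (\<i>\<d> A) = A"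
  and Tgt_ident: "A \<in> Ob C \<Longrightarrow> Tgt C (\<i>\<d> A) = A"
  using ident[of A] by (auto simp: hom_def)

lemma comp_ident': "\<lbrakk>f \<in> Ar C; Src C f = A\<rbrakk> \<Longrightarrow> f \<cdot> \<i>\<d> A = f"
  using comp_ident[of f A "Tgt C f"] by (auto simp: hom_def)

lemma ident_comp': "\<lbrakk>f \<in> Ar C; Tgt C f = A\<rbrakk> \<Longrightarrow> \<i>\<d> A \<cdot> f = f"
  using ident_comp[of f "Src C f" A] by (auto simp: hom_def)

lemma comp_assoc':
  "\<lbrakk>f \<in> Ar C; g \<in> Ar C; h \<in> Ar C; Tgt C f = Src C g; Tgt C g = Src C h\<rbrakk>
    \<Longrightarrow> (h \<cdot> g) \<cdot> f = h \<cdot> (g \<cdot> f)"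
  using comp_assoc[of f "Src C f" "Tgt C f" g "Tgt C g" h "Tgt C h"] by (auto simp: hom_def)

lemma hom_Ob: "f \<in> hom C A B \<Longrightarrow> A \<in> Ob C" "f \<in> hom C A B \<Longrightarrow> B \<in> Ob C"
  using src tgt by (auto simp: hom_def)

lemma monoD:
  "\<lbrakk>mono C f; f \<in> hom C A B; g \<in> hom C T A; h \<in> hom C T A; f \<cdot> g = f \<cdot> h\<rbrakk> \<Longrightarrow> g = h"
  unfolding mono_def hom_def by blast

lemma monoI:
  assumes "f \<in> hom C A B" "\<And>T g h. \<lbrakk>g \<in> hom C T A; h \<in> hom C T A; f \<cdot> g = f \<cdot> h\<rbrakk> \<Longrightarrow> g = h"
  shows "mono C f"
proof -
  have f: "f \<in> Ar C" "Src C f = A" using assms(1) by (simp_all add: hom_def)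
  show ?thesis
    unfolding mono_def f(2) by (intro conjI ballI allI impI f(1)) (rule assms(2))
qed

lemma split_mono:
  assumes "f \<in> hom C A B" "p \<in> hom C B A" "p \<cdot> f = \<i>\<d> A"
  shows "mono C f"
proof (rule monoI[OF assms(1)])
  fix T g h assume gh: "g \<in> hom C T A" "h \<in> hom C T A" "f \<cdot> g = f \<cdot> h"
  have "g = (p \<cdot> f) \<cdot> g" by (simp add: assms(3) ident_comp[OF gh(1)])
  also have "\<dots> = (p \<cdot> f) \<cdot> h"
    by (simp only: comp_assoc[OF gh(1) assms(1,2)] comp_assoc[OF gh(2) assms(1,2)] gh(3))
  also have "\<dots> = h" by (simp add: assms(3) ident_comp[OF gh(2)])
  finally show "g = h" .
qed

lemma is_intersectionE:
  assumes "is_intersection C D j a b" "a \<in> hom C A Y" "b \<in> hom C B Y"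
  obtains f g where "f \<in> hom C D A" "g \<in> hom C D B" "j = a \<cdot> f" "j = b \<cdot> g"
    "\<forall>T. \<forall>s\<in>hom C T A. \<forall>t\<in>hom C T B. a \<cdot> s = b \<cdot> t \<longrightarrow>
      (\<exists>!u. u \<in> hom C T D \<and> f \<cdot> u = s \<and> g \<cdot> u = t)"
proof -
  have src: "Src C a = A" "Src C b = B"
    using assms(2,3) by (simp_all add: hom_def)
  from assms(1)[unfolded is_intersection_def src] obtain f g where
    fg: "f \<in> hom C D A" "g \<in> hom C D B" "a \<cdot> f = b \<cdot> g" "j = a \<cdot> f"
    and univ: "\<forall>T. \<forall>s\<in>hom C T A. \<forall>t\<in>hom C T B. a \<cdot> s = b \<cdot> t \<longrightarrow>
      (\<exists>!u. u \<in> hom C T D \<and> f \<cdot> u = s \<and> g \<cdot> u = t)"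
    by (elim bexE conjE) (rule that)
  have "j = b \<cdot> g" using fg(3,4) by simp
  then show ?thesis
    using that[OF fg(1,2,4) _ univ] by blast
qed

lemma intersection_factor:
  assumes I: "is_intersection C D j a b" and a: "a \<in> hom C A Y" and b: "b \<in> hom C B Y"
    and st: "s \<in> hom C T A" "t \<in> hom C T B" "a \<cdot> s = b \<cdot> t"
  obtains u where "u \<in> hom C T D" "j \<cdot> u = a \<cdot> s"
proof -
  obtain f g where f: "f \<in> hom C D A" "j = a \<cdot> f"
    and univ: "\<forall>T. \<forall>s\<in>hom C T A. \<forall>t\<in>hom C T B. a \<cdot> s = b \<cdot> t \<longrightarrow>
      (\<exists>!u. u \<in> hom C T D \<and> f \<cdot> u = s \<and> g \<cdot> u = t)"
    using is_intersectionE[OF I a b] .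
  from univ st obtain u where u: "u \<in> hom C T D" "f \<cdot> u = s" by blast
  then have "j \<cdot> u = a \<cdot> s"
    using comp_assoc[OF u(1) f(1) a] by (simp add: f(2))
  with u(1) show ?thesis by (rule that)
qed

text \<open>A pullback of two monomorphisms is contained in both, so two maps into it that agree after \<open>j\<close>
  have the same components.\<close>
lemma intersection_mono:
  assumes I: "is_intersection C D j a b" and a: "mono C a" "a \<in> hom C A Y"
    and b: "mono C b" "b \<in> hom C B Y"
  shows "mono C j"
proof -
  obtain f g where fg: "f \<in> hom C D A" "g \<in> hom C D B" "j = a \<cdot> f" "j = b \<cdot> g"
    and univ: "\<forall>T. \<forall>s\<in>hom C T A. \<forall>t\<in>hom C T B. a \<cdot> s = b \<cdot> t \<longrightarrow>
      (\<exists>!u. u \<in> hom C T D \<and> f \<cdot> u = s \<and> g \<cdot> u = t)"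
    using is_intersectionE[OF I a(2) b(2)] .
  show ?thesis
  proof (rule monoI)
    show "j \<in> hom C D Y" unfolding fg(3) by (rule comp[OF fg(1) a(2)])
    fix T u v assume uv: "u \<in> hom C T D" "v \<in> hom C T D" "j \<cdot> u = j \<cdot> v"
    have "a \<cdot> (f \<cdot> u) = a \<cdot> (f \<cdot> v)"
      using uv(3) unfolding comp_assoc[OF uv(1) fg(1) a(2), symmetric]
        comp_assoc[OF uv(2) fg(1) a(2), symmetric] fg(3)[symmetric] .
    then have f: "f \<cdot> v = f \<cdot> u"
      by (rule monoD[OF a comp[OF uv(2) fg(1)] comp[OF uv(1) fg(1)] sym])
    have "b \<cdot> (g \<cdot> u) = b \<cdot> (g \<cdot> v)"
      using uv(3) unfolding comp_assoc[OF uv(1) fg(2) b(2), symmetric]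
        comp_assoc[OF uv(2) fg(2) b(2), symmetric] fg(4)[symmetric] .
    then have g: "g \<cdot> v = g \<cdot> u"
      by (rule monoD[OF b comp[OF uv(2) fg(2)] comp[OF uv(1) fg(2)] sym])
    have "a \<cdot> (f \<cdot> u) = j \<cdot> u" "b \<cdot> (g \<cdot> u) = j \<cdot> u"
      unfolding comp_assoc[OF uv(1) fg(1) a(2), symmetric]
        comp_assoc[OF uv(1) fg(2) b(2), symmetric] by (simp_all only: fg(3,4)[symmetric])
    then have "a \<cdot> (f \<cdot> u) = b \<cdot> (g \<cdot> u)" by (rule trans[OF _ sym])
    then have "\<exists>!w. w \<in> hom C T D \<and> f \<cdot> w = f \<cdot> u \<and> g \<cdot> w = g \<cdot> u"
      using univ comp[OF uv(1) fg(1)] comp[OF uv(1) fg(2)] by blast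
    then show "u = v" using uv(1,2) f g by blast
  qed
qed

lemma intersection_commute:
  assumes I: "is_intersection C D j a b" and a: "a \<in> hom C A Y" and b: "b \<in> hom C B Y"
  shows "is_intersection C D j b a"
proof -
  obtain f g where fg: "f \<in> hom C D A" "g \<in> hom C D B" "j = a \<cdot> f" "j = b \<cdot> g"
    and univ: "\<forall>T. \<forall>s\<in>hom C T A. \<forall>t\<in>hom C T B. a \<cdot> s = b \<cdot> t \<longrightarrow>
      (\<exists>!u. u \<in> hom C T D \<and> f \<cdot> u = s \<and> g \<cdot> u = t)"
    using is_intersectionE[OF I a b] .
  have src: "Src C a = A" "Src C b = B" using a b by (simp_all add: hom_def)
  show ?thesis
    unfolding is_intersection_def src
  proof (rule bexI[of _ g], rule bexI[of _ f], intro conjI allI ballI impI)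
    show "D \<in> Ob C" by (rule hom_Ob(1)[OF fg(1)])
    show "b \<cdot> g = a \<cdot> f" by (rule trans[OF fg(4)[symmetric] fg(3)])
    fix T t s assume ts: "t \<in> hom C T B" "s \<in> hom C T A" "b \<cdot> t = a \<cdot> s"
    have "\<exists>!u. u \<in> hom C T D \<and> f \<cdot> u = s \<and> g \<cdot> u = t"
      by (rule univ[rule_format, OF ts(2,1) ts(3)[symmetric]])
    then show "\<exists>!u. u \<in> hom C T D \<and> g \<cdot> u = t \<and> f \<cdot> u = s"
      by (rule back_subst[where P = Ex1]) auto
  qed (fact fg)+
qed

text \<open>This computes the intersections with the top element \<open>[X]\<close>.\<close>
lemma intersection_of_factor:
  assumes a: "mono C a" "a \<in> hom C A Y" and b: "b \<in> hom C B Y"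
    and h: "h \<in> hom C B A" "b = a \<cdot> h"
  shows "is_intersection C B b a b"
proof -
  have src: "Src C a = A" "Src C b = B" using a b by (simp_all add: hom_def)
  have I: "\<i>\<d> B \<in> hom C B B" "b \<cdot> \<i>\<d> B = b"
    using ident[OF hom_Ob(1)[OF b]] comp_ident[OF b] by simp_all
  show ?thesis
    unfolding is_intersection_def src
  proof (rule bexI[of _ h], rule bexI[of _ "\<i>\<d> B"], intro conjI allI ballI impI)
    show "B \<in> Ob C" by (rule hom_Ob(1)[OF b])
    show "a \<cdot> h = b \<cdot> \<i>\<d> B" by (rule trans[OF h(2)[symmetric] I(2)[symmetric]])
    fix T s t assume st: "s \<in> hom C T A" "t \<in> hom C T B" "a \<cdot> s = b \<cdot> t"
    have "a \<cdot> (h \<cdot> t) = a \<cdot> s"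
      using st(3) unfolding comp_assoc[OF st(2) h(1) a(2), symmetric] h(2)[symmetric] by (rule sym)
    then have "h \<cdot> t = s" by (rule monoD[OF a comp[OF st(2) h(1)] st(1)])
    show "\<exists>!u. u \<in> hom C T B \<and> h \<cdot> u = s \<and> \<i>\<d> B \<cdot> u = t"
    proof (rule ex1I[of _ t])
      show "t \<in> hom C T B \<and> h \<cdot> t = s \<and> \<i>\<d> B \<cdot> t = t"
        using st(2) \<open>h \<cdot> t = s\<close> ident_comp[OF st(2)] by blast
      fix u assume u: "u \<in> hom C T B \<and> h \<cdot> u = s \<and> \<i>\<d> B \<cdot> u = t"
      then show "u = t" using ident_comp[of u T B] by simp
    qed
  qed (fact h I)+
qed

end

section \<open>Calculation in strict monoidal categories\<close>

context strict_monoidal_category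
begin

lemma Ar_tens: "\<lbrakk>f \<in> Ar C; g \<in> Ar C\<rbrakk> \<Longrightarrow> f \<otimes> g \<in> Ar C"
  and Src_tens: "\<lbrakk>f \<in> Ar C; g \<in> Ar C\<rbrakk> \<Longrightarrow> Src C (f \<otimes> g) = Src C f \<odot> Src C g"
  and Tgt_tens: "\<lbrakk>f \<in> Ar C; g \<in> Ar C\<rbrakk> \<Longrightarrow> Tgt C (f \<otimes> g) = Tgt C f \<odot> Tgt C g"
  using tensA[of f "Src C f" "Tgt C f" g "Src C g" "Tgt C g"] by (auto simp: hom_def)

text \<open>The interchange law is kept out of the rules for calculation below. Those together with whiskering
  expand a string diagram into layers with one nontrivial box each; two boxes are then moved past
  each other by combining \<open>slide_left\<close> and \<open>slide_right\<close>.\<close>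
lemma interchange:
  "\<lbrakk>f \<in> Ar C; f' \<in> Ar C; g \<in> Ar C; g' \<in> Ar C; Tgt C f = Src C f'; Tgt C g = Src C g'\<rbrakk>
    \<Longrightarrow> (f' \<otimes> g') \<cdot> (f \<otimes> g) = (f' \<cdot> f) \<otimes> (g' \<cdot> g)"
  using tensA_comp[of f "Src C f" "Tgt C f" f' "Tgt C f'" g "Src C g" "Tgt C g" g' "Tgt C g'"]
  by (auto simp: hom_def)

lemmas monoidal_typing = src tgt unit tensO Ar_comp Src_comp Tgt_comp Ar_tens Src_tens Tgt_tens
  Ar_ident Src_ident Tgt_ident tensO_assoc unit_tensO tensO_unit

lemmas monoidal_calc = monoidal_typing comp_ident' ident_comp' tensA_ident tensA_assoc
  unit_tensA tensA_unit comp_assoc'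

lemma whisker_right:
  "\<lbrakk>f \<in> Ar C; g \<in> Ar C; Tgt C f = Src C g; A \<in> Ob C\<rbrakk>
    \<Longrightarrow> (g \<cdot> f) \<otimes> \<i>\<d> A = (g \<otimes> \<i>\<d> A) \<cdot> (f \<otimes> \<i>\<d> A)"
  by (simp add: interchange monoidal_calc)

lemma whisker_left:
  "\<lbrakk>f \<in> Ar C; g \<in> Ar C; Tgt C f = Src C g; A \<in> Ob C\<rbrakk>
    \<Longrightarrow> \<i>\<d> A \<otimes> (g \<cdot> f) = (\<i>\<d> A \<otimes> g) \<cdot> (\<i>\<d> A \<otimes> f)"
  by (simp add: interchange monoidal_calc)

lemma slide_right:
  "\<lbrakk>f \<in> Ar C; g \<in> Ar C; Src C f = A; Tgt C g = B\<rbrakk>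
    \<Longrightarrow> (f \<otimes> \<i>\<d> B) \<cdot> (\<i>\<d> A \<otimes> g) = f \<otimes> g"
  by (auto simp: interchange monoidal_calc)

lemma slide_left:
  "\<lbrakk>f \<in> Ar C; g \<in> Ar C; Tgt C f = A; Src C g = B\<rbrakk>
    \<Longrightarrow> (\<i>\<d> A \<otimes> g) \<cdot> (f \<otimes> \<i>\<d> B) = f \<otimes> g"
  by (auto simp: interchange monoidal_calc)

end

section \<open>Dual morphisms\<close>

context strict_monoidal_category
begin

lemma is_left_dualD:
  assumes "is_left_dual C X Y ev coev"
  shows "X \<in> Ob C" "Y \<in> Ob C" "ev \<in> Ar C" "Src C ev = Y \<odot> X" "Tgt C ev = \<one>"
    "coev \<in> Ar C" "Src C coev = \<one>" "Tgt C coev = X \<odot> Y"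
    "(\<i>\<d> X \<otimes> ev) \<cdot> (coev \<otimes> \<i>\<d> X) = \<i>\<d> X"
    "(ev \<otimes> \<i>\<d> Y) \<cdot> (\<i>\<d> Y \<otimes> coev) = \<i>\<d> Y"
  using assms by (auto simp: is_left_dual_def hom_def)

text \<open>The equation \<open>ev (h \<otimes> id) = ev (id \<otimes> f)\<close> characterizes \<open>h = f\<^sup>*\<close>: bending the second strand on both
  sides, the zigzag identity leaves \<open>h\<close> on the left, and the right is the definition of \<open>f\<^sup>*\<close>. All
  dual morphisms below are found through this equation.\<close>
lemma dual_mor_unique:
  assumes X: "is_left_dual C X Xs evX coevX" and Y: "is_left_dual C Y Ys evY coevY"
    and f: "f \<in> hom C X Y" and h: "h \<in> hom C Ys Xs"
    and eq: "evX \<cdot> (h \<otimes> \<i>\<d> X) = evY \<cdot> (\<i>\<d> Ys \<otimes> f)"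
  shows "dual_mor C Xs coevX Ys evY f = h"
proof -
  note X = is_left_dualD[OF X] and Y = is_left_dualD[OF Y]
  have f: "f \<in> Ar C" "Src C f = X" "Tgt C f = Y" and h: "h \<in> Ar C" "Src C h = Ys" "Tgt C h = Xs"
    using f h by (auto simp: hom_def)
  note ty = X(1-8) Y(1-8) f h
  have "dual_mor C Xs coevX Ys evY f = ((evY \<cdot> (\<i>\<d> Ys \<otimes> f)) \<otimes> \<i>\<d> Xs) \<cdot> (\<i>\<d> Ys \<otimes> coevX)"
    using ty by (simp add: dual_mor_def monoidal_calc whisker_right)
  also have "\<dots> = (evX \<otimes> \<i>\<d> Xs) \<cdot> ((h \<otimes> \<i>\<d> (X \<odot> Xs)) \<cdot> (\<i>\<d> Ys \<otimes> coevX))"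
    using ty by (simp add: monoidal_calc whisker_right flip: eq)
  also have "\<dots> = (evX \<otimes> \<i>\<d> Xs) \<cdot> ((\<i>\<d> Xs \<otimes> coevX) \<cdot> (h \<otimes> \<i>\<d> \<one>))"
    using ty by (simp only: slide_right slide_left)
  also have "\<dots> = ((evX \<otimes> \<i>\<d> Xs) \<cdot> (\<i>\<d> Xs \<otimes> coevX)) \<cdot> h"
    using ty by (simp add: monoidal_calc)
  also have "\<dots> = h"
    using X(10) ty by (simp only: ident_comp')
  finally show ?thesis .
qed

lemma dual_mor_hom:
  assumes X: "is_left_dual C X Xs evX coevX" and Y: "is_left_dual C Y Ys evY coevY"
    and f: "f \<in> hom C X Y"
  shows "dual_mor C Xs coevX Ys evY f \<in> hom C Ys Xs"
  using is_left_dualD[OF X] is_left_dualD[OF Y] f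
  by (auto simp: dual_mor_def hom_def monoidal_typing)

lemma ev_dual_mor:
  assumes X: "is_left_dual C X Xs evX coevX" and Y: "is_left_dual C Y Ys evY coevY"
    and f: "f \<in> hom C X Y"
  shows "evX \<cdot> (dual_mor C Xs coevX Ys evY f \<otimes> \<i>\<d> X) = evY \<cdot> (\<i>\<d> Ys \<otimes> f)"
proof -
  note X = is_left_dualD[OF X] and Y = is_left_dualD[OF Y]
  have f: "f \<in> Ar C" "Src C f = X" "Tgt C f = Y"
    using f by (auto simp: hom_def)
  note ty = X(1-8) Y(1-8) f
  define g where "g = evY \<cdot> (\<i>\<d> Ys \<otimes> f)"
  have g: "g \<in> Ar C" "Src C g = Ys \<odot> X" "Tgt C g = \<one>"
    using ty by (auto simp: g_def monoidal_typing)
  have "dual_mor C Xs coevX Ys evY f = (g \<otimes> \<i>\<d> Xs) \<cdot> (\<i>\<d> Ys \<otimes> coevX)"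
    using ty by (simp add: dual_mor_def g_def monoidal_calc whisker_right)
  then have "evX \<cdot> (dual_mor C Xs coevX Ys evY f \<otimes> \<i>\<d> X)
      = (evX \<cdot> (g \<otimes> \<i>\<d> (Xs \<odot> X))) \<cdot> (\<i>\<d> Ys \<otimes> coevX \<otimes> \<i>\<d> X)"
    using ty g by (simp add: monoidal_calc whisker_right)
  also have "evX \<cdot> (g \<otimes> \<i>\<d> (Xs \<odot> X)) = g \<cdot> (\<i>\<d> (Ys \<odot> X) \<otimes> evX)"
    using ty g slide_left[of g evX \<one> "Xs \<odot> X"] slide_right[of g evX "Ys \<odot> X" \<one>]
    by (simp add: monoidal_calc)
  also have "(\<dots>) \<cdot> (\<i>\<d> Ys \<otimes> coevX \<otimes> \<i>\<d> X)
      = g \<cdot> (\<i>\<d> Ys \<otimes> ((\<i>\<d> X \<otimes> evX) \<cdot> (coevX \<otimes> \<i>\<d> X)))"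
    using ty g by (simp add: monoidal_calc whisker_left flip: tensA_ident)
  also have "\<dots> = g"
    using X(9) ty g by (simp add: monoidal_calc)
  finally show ?thesis by (simp add: g_def)
qed

text \<open>In \<open>ev (f\<^sup>* g\<^sup>* \<otimes> id)\<close> first \<open>f\<close> and then \<open>g\<close> are moved across the evaluation.\<close>
lemma dual_mor_comp:
  assumes X: "is_left_dual C X Xs evX coevX" and Y: "is_left_dual C Y Ys evY coevY"
    and Z: "is_left_dual C Z Zs evZ coevZ"
    and f: "f \<in> hom C X Y" and g: "g \<in> hom C Y Z"
  shows "dual_mor C Xs coevX Zs evZ (g \<cdot> f)
    = dual_mor C Xs coevX Ys evY f \<cdot> dual_mor C Ys coevY Zs evZ g"
proof (rule dual_mor_unique[OF X Z comp[OF f g]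
      comp[OF dual_mor_hom[OF Y Z g] dual_mor_hom[OF X Y f]]])
  let ?f = "dual_mor C Xs coevX Ys evY f" and ?g = "dual_mor C Ys coevY Zs evZ g"
  have f': "?f \<in> Ar C" "Src C ?f = Ys" "Tgt C ?f = Xs" "f \<in> Ar C" "Src C f = X" "Tgt C f = Y"
    and g': "?g \<in> Ar C" "Src C ?g = Zs" "Tgt C ?g = Ys" "g \<in> Ar C" "Src C g = Y" "Tgt C g = Z"
    using dual_mor_hom[OF X Y f] dual_mor_hom[OF Y Z g] f g by (auto simp: hom_def)
  note ty = is_left_dualD(1-8)[OF X] is_left_dualD(1-8)[OF Y] is_left_dualD(1-8)[OF Z] f' g'
  have "evX \<cdot> ((?f \<cdot> ?g) \<otimes> \<i>\<d> X) = (evX \<cdot> (?f \<otimes> \<i>\<d> X)) \<cdot> (?g \<otimes> \<i>\<d> X)"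
    using ty by (simp add: monoidal_calc whisker_left whisker_right)
  also have "\<dots> = evY \<cdot> ((\<i>\<d> Ys \<otimes> f) \<cdot> (?g \<otimes> \<i>\<d> X))"
    using ty by (simp add: monoidal_calc ev_dual_mor[OF X Y f])
  also have "(\<i>\<d> Ys \<otimes> f) \<cdot> (?g \<otimes> \<i>\<d> X) = (?g \<otimes> \<i>\<d> Y) \<cdot> (\<i>\<d> Zs \<otimes> f)"
    using ty by (simp only: slide_left slide_right)
  also have "evY \<cdot> (\<dots>) = (evY \<cdot> (?g \<otimes> \<i>\<d> Y)) \<cdot> (\<i>\<d> Zs \<otimes> f)"
    using ty by (simp add: monoidal_calc)
  also have "\<dots> = evZ \<cdot> (\<i>\<d> Zs \<otimes> (g \<cdot> f))"
    using ty by (simp add: monoidal_calc whisker_left whisker_right ev_dual_mor[OF Y Z g])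
  finally show "evX \<cdot> ((?f \<cdot> ?g) \<otimes> \<i>\<d> X) = evZ \<cdot> (\<i>\<d> Zs \<otimes> (g \<cdot> f))" .
qed

lemma dual_mor_ident:
  assumes X: "is_left_dual C X Xs evX coevX"
  shows "dual_mor C Xs coevX Xs evX (\<i>\<d> X) = \<i>\<d> Xs"
  using is_left_dualD(1,2)[OF X] by (intro dual_mor_unique[OF X X] ident) auto

end

section \<open>Frobenius algebras and nondegenerate forms\<close>

context frobenius_algebra
begin

lemma frobenius_typing:
  "fob F \<in> Ob C"
  "fmult F \<in> Ar C" "Src C (fmult F) = fob F \<odot> fob F" "Tgt C (fmult F) = fob F"
  "fcomult F \<in> Ar C" "Src C (fcomult F) = fob F" "Tgt C (fcomult F) = fob F \<odot> fob F"
  "funit F \<in> Ar C" "Src C (funit F) = \<one>" "Tgt C (funit F) = fob F"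
  "fcounit F \<in> Ar C" "Src C (fcounit F) = fob F" "Tgt C (fcounit F) = \<one>"
  using fob fmult fcomult funit fcounit by (auto simp: hom_def)

text \<open>The Frobenius relation turns either zigzag into \<open>\<delta>\<close> followed by a counit, after \<open>m\<close> preceded by a
  unit.\<close>
lemma frobenius_selfdual: "is_left_dual C (fob F) (fob F) (fev C F) (fcoev C F)"
proof -
  note ty = frobenius_typing
  let ?I = "\<i>\<d> (fob F)"
  have "(?I \<otimes> fev C F) \<cdot> (fcoev C F \<otimes> ?I)
      = (?I \<otimes> fcounit F) \<cdot> (((?I \<otimes> fmult F) \<cdot> (fcomult F \<otimes> ?I)) \<cdot> (funit F \<otimes> ?I))"
    using ty by (simp add: fev_def fcoev_def monoidal_calc whisker_left whisker_right)
  also have "\<dots> = ((?I \<otimes> fcounit F) \<cdot> fcomult F) \<cdot> (fmult F \<cdot> (funit F \<otimes> ?I))"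
    unfolding frobenius_left using ty by (simp add: monoidal_calc)
  also have "\<dots> = ?I"
    using ty by (simp only: fcounit_right funit_left ident_comp' Ar_ident Tgt_ident)
  finally have zigzag1: "(?I \<otimes> fev C F) \<cdot> (fcoev C F \<otimes> ?I) = ?I" .
  have "(fev C F \<otimes> ?I) \<cdot> (?I \<otimes> fcoev C F)
      = (fcounit F \<otimes> ?I) \<cdot> (((fmult F \<otimes> ?I) \<cdot> (?I \<otimes> fcomult F)) \<cdot> (?I \<otimes> funit F))"
    using ty by (simp add: fev_def fcoev_def monoidal_calc whisker_left whisker_right)
  also have "\<dots> = ((fcounit F \<otimes> ?I) \<cdot> fcomult F) \<cdot> (fmult F \<cdot> (?I \<otimes> funit F))"
    unfolding frobenius_right using ty by (simp add: monoidal_calc)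
  also have "\<dots> = ?I"
    using ty by (simp only: fcounit_left funit_right ident_comp' Ar_ident Tgt_ident)
  finally have zigzag2: "(fev C F \<otimes> ?I) \<cdot> (?I \<otimes> fcoev C F) = ?I" .
  show ?thesis
    using ty zigzag1 zigzag2
    by (auto simp: is_left_dual_def hom_def fev_def fcoev_def monoidal_typing)
qed

end

context strict_monoidal_category
begin

text \<open>The comultiplication \<open>\<delta> = (m \<otimes> id) (id \<otimes> c)\<close> is \<open>m\<close> with its second input bent to an output. By
  associativity \<open>\<delta>\<close> is also \<open>(id \<otimes> m) (c \<otimes> id)\<close>, and each remaining law follows from one of the two
  formulas: the first gives the right Frobenius relation, the second the left one, and together
  they give coassociativity; the counit laws are the zigzag identities.\<close>
lemma frobenius_algebra_of_nondegenerate_form: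
  fixes F :: "('a, 'b) frob"
  assumes dual: "is_left_dual C (fob F) (fob F) (fcounit F \<cdot> fmult F) c"
    and m: "fmult F \<in> hom C (fob F \<odot> fob F) (fob F)"
    and e: "funit F \<in> hom C \<one> (fob F)"
    and eps: "fcounit F \<in> hom C (fob F) \<one>"
    and assoc: "fmult F \<cdot> (fmult F \<otimes> \<i>\<d> (fob F)) = fmult F \<cdot> (\<i>\<d> (fob F) \<otimes> fmult F)"
    and unit_l: "fmult F \<cdot> (funit F \<otimes> \<i>\<d> (fob F)) = \<i>\<d> (fob F)"
    and unit_r: "fmult F \<cdot> (\<i>\<d> (fob F) \<otimes> funit F) = \<i>\<d> (fob F)"
    and comult: "fcomult F = (fmult F \<otimes> \<i>\<d> (fob F)) \<cdot> (\<i>\<d> (fob F) \<otimes> c)"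
  shows "frobenius_algebra C F" and "fcoev C F = c"
proof -
  define D m e \<epsilon> where defs: "D = fob F" "m = fmult F" "e = funit F" "\<epsilon> = fcounit F"
  define I where "I = \<i>\<d> D"
  note defs' = defs[symmetric]
  have ty0: "D \<in> Ob C" "m \<in> Ar C" "Src C m = D \<odot> D" "Tgt C m = D"
    "e \<in> Ar C" "Src C e = \<one>" "Tgt C e = D" "\<epsilon> \<in> Ar C" "Src C \<epsilon> = D" "Tgt C \<epsilon> = \<one>"
    "c \<in> Ar C" "Src C c = \<one>" "Tgt C c = D \<odot> D"
    using assms(2-4) is_left_dualD[OF dual] by (auto simp: hom_def defs)
  then have "I \<in> Ar C" "Src C I = D" "Tgt C I = D"
    by (auto simp: I_def monoidal_typing)
  note ty = ty0 this
  have zig: "(I \<otimes> (\<epsilon> \<cdot> m)) \<cdot> (c \<otimes> I) = I" and zag: "((\<epsilon> \<cdot> m) \<otimes> I) \<cdot> (I \<otimes> c) = I"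
    using is_left_dualD(9,10)[OF dual] by (simp_all add: defs I_def)
  note assoc = assoc[unfolded defs', folded I_def]
    and unit_l = unit_l[unfolded defs', folded I_def]
    and unit_r = unit_r[unfolded defs', folded I_def]
  define \<delta> where "\<delta> = (m \<otimes> I) \<cdot> (I \<otimes> c)"
  have \<delta>: "\<delta> \<in> Ar C" "Src C \<delta> = D" "Tgt C \<delta> = D \<odot> D"
    using ty by (auto simp: \<delta>_def monoidal_typing)
  note ty = ty \<delta>
  have comult: "fcomult F = \<delta>"
    using comult by (simp add: \<delta>_def defs I_def)
  \<comment> \<open>A morphism into \<open>D \<odot> D\<close> is recovered from its pairing with the form by bending the paired strand
      back.\<close>
  have recover: "(((I \<otimes> (\<epsilon> \<cdot> m)) \<cdot> (h \<otimes> I)) \<otimes> I) \<cdot> (I \<otimes> c) = h"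
    if h: "h \<in> Ar C" "Src C h = D" "Tgt C h = D \<odot> D" for h
  proof -
    have "(((I \<otimes> (\<epsilon> \<cdot> m)) \<cdot> (h \<otimes> I)) \<otimes> I) \<cdot> (I \<otimes> c)
        = (I \<otimes> (\<epsilon> \<cdot> m) \<otimes> I) \<cdot> ((h \<otimes> \<i>\<d> (D \<odot> D)) \<cdot> (I \<otimes> c))"
      using ty h by (simp add: monoidal_calc whisker_left whisker_right I_def)
    also have "(h \<otimes> \<i>\<d> (D \<odot> D)) \<cdot> (I \<otimes> c) = (\<i>\<d> (D \<odot> D) \<otimes> c) \<cdot> (h \<otimes> \<i>\<d> \<one>)"
      using ty h unfolding I_def by (simp only: slide_left slide_right)
    also have "(I \<otimes> (\<epsilon> \<cdot> m) \<otimes> I) \<cdot> (\<dots>) = (I \<otimes> (((\<epsilon> \<cdot> m) \<otimes> I) \<cdot> (I \<otimes> c))) \<cdot> h"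
      using ty h by (simp add: monoidal_calc whisker_left whisker_right I_def flip: tensA_ident)
    also have "\<dots> = h"
      unfolding zag using ty h by (simp add: monoidal_calc I_def)
    finally show ?thesis .
  qed
  \<comment> \<open>Paired with the form, both formulas for the comultiplication give back \<open>m\<close>, so they agree.\<close>
  define \<delta>' where "\<delta>' = (I \<otimes> m) \<cdot> (c \<otimes> I)"
  have \<delta>': "\<delta>' \<in> Ar C" "Src C \<delta>' = D" "Tgt C \<delta>' = D \<odot> D"
    using ty by (auto simp: \<delta>'_def monoidal_typing)
  have "(I \<otimes> (\<epsilon> \<cdot> m)) \<cdot> (\<delta> \<otimes> I) = ((I \<otimes> (\<epsilon> \<cdot> m)) \<cdot> (m \<otimes> \<i>\<d> (D \<odot> D))) \<cdot> (I \<otimes> c \<otimes> I)"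
    using ty0 by (simp add: monoidal_calc whisker_left whisker_right \<delta>_def I_def)
  also have "(I \<otimes> (\<epsilon> \<cdot> m)) \<cdot> (m \<otimes> \<i>\<d> (D \<odot> D)) = (m \<otimes> \<i>\<d> \<one>) \<cdot> (\<i>\<d> (D \<odot> D) \<otimes> (\<epsilon> \<cdot> m))"
    using ty0 slide_left[of m "\<epsilon> \<cdot> m" D "D \<odot> D"] slide_right[of m "\<epsilon> \<cdot> m" "D \<odot> D" \<one>]
    by (simp add: monoidal_typing I_def)
  also have "(\<dots>) \<cdot> (I \<otimes> c \<otimes> I) = m \<cdot> (I \<otimes> ((I \<otimes> (\<epsilon> \<cdot> m)) \<cdot> (c \<otimes> I)))"
    using ty0 by (simp add: monoidal_calc whisker_left whisker_right I_def flip: tensA_ident)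
  also have "\<dots> = m"
    unfolding zig using ty0 by (simp add: monoidal_calc I_def)
  finally have pair_\<delta>: "(I \<otimes> (\<epsilon> \<cdot> m)) \<cdot> (\<delta> \<otimes> I) = m" .
  have "(I \<otimes> (\<epsilon> \<cdot> m)) \<cdot> (\<delta>' \<otimes> I)
      = ((I \<otimes> \<epsilon>) \<cdot> (I \<otimes> (m \<cdot> (m \<otimes> I)))) \<cdot> (c \<otimes> \<i>\<d> (D \<odot> D))"
    using ty0 by (simp add: monoidal_calc whisker_left whisker_right \<delta>'_def I_def)
  also have "\<dots> = (I \<otimes> (\<epsilon> \<cdot> m)) \<cdot> ((\<i>\<d> (D \<odot> D) \<otimes> m) \<cdot> (c \<otimes> \<i>\<d> (D \<odot> D)))"
    unfolding assoc using ty0 by (simp add: monoidal_calc whisker_left whisker_right I_def flip: tensA_ident)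
  also have "(\<i>\<d> (D \<odot> D) \<otimes> m) \<cdot> (c \<otimes> \<i>\<d> (D \<odot> D)) = (c \<otimes> I) \<cdot> (\<i>\<d> \<one> \<otimes> m)"
    using ty0 unfolding I_def by (simp only: slide_left slide_right)
  also have "(I \<otimes> (\<epsilon> \<cdot> m)) \<cdot> (\<dots>) = ((I \<otimes> (\<epsilon> \<cdot> m)) \<cdot> (c \<otimes> I)) \<cdot> m"
    using ty0 by (simp add: monoidal_calc I_def)
  also have "\<dots> = m"
    unfolding zig using ty0 by (simp add: monoidal_calc I_def)
  finally have pair_\<delta>': "(I \<otimes> (\<epsilon> \<cdot> m)) \<cdot> (\<delta>' \<otimes> I) = m" .
  have \<delta>_alt: "\<delta> = (I \<otimes> m) \<cdot> (c \<otimes> I)"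
    using recover[OF \<delta>] recover[OF \<delta>'] pair_\<delta> pair_\<delta>' by (simp add: \<delta>'_def)
  have "(m \<otimes> I) \<cdot> (I \<otimes> \<delta>) = ((m \<cdot> (I \<otimes> m)) \<otimes> I) \<cdot> (\<i>\<d> (D \<odot> D) \<otimes> c)"
    using ty0 by (simp add: monoidal_calc whisker_left whisker_right \<delta>_def I_def flip: tensA_ident)
  also have "\<dots> = (m \<otimes> I) \<cdot> ((m \<otimes> \<i>\<d> (D \<odot> D)) \<cdot> (\<i>\<d> (D \<odot> D) \<otimes> c))"
    unfolding assoc[symmetric] using ty0 by (simp add: monoidal_calc whisker_left whisker_right I_def)
  also have "(m \<otimes> \<i>\<d> (D \<odot> D)) \<cdot> (\<i>\<d> (D \<odot> D) \<otimes> c) = (I \<otimes> c) \<cdot> (m \<otimes> \<i>\<d> \<one>)"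
    using ty0 unfolding I_def by (simp only: slide_left slide_right)
  also have "(m \<otimes> I) \<cdot> (\<dots>) = \<delta> \<cdot> m"
    using ty0 by (simp add: monoidal_calc \<delta>_def I_def)
  finally have frob_r: "(m \<otimes> I) \<cdot> (I \<otimes> \<delta>) = \<delta> \<cdot> m" .
  have "(I \<otimes> m) \<cdot> (\<delta> \<otimes> I) = (I \<otimes> (m \<cdot> (m \<otimes> I))) \<cdot> (c \<otimes> \<i>\<d> (D \<odot> D))"
    unfolding \<delta>_alt using ty0 by (simp add: monoidal_calc whisker_left whisker_right I_def)
  also have "\<dots> = (I \<otimes> m) \<cdot> ((\<i>\<d> (D \<odot> D) \<otimes> m) \<cdot> (c \<otimes> \<i>\<d> (D \<odot> D)))"
    unfolding assoc using ty0 by (simp add: monoidal_calc whisker_left whisker_right I_def flip: tensA_ident)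
  also have "(\<i>\<d> (D \<odot> D) \<otimes> m) \<cdot> (c \<otimes> \<i>\<d> (D \<odot> D)) = (c \<otimes> I) \<cdot> (\<i>\<d> \<one> \<otimes> m)"
    using ty0 unfolding I_def by (simp only: slide_left slide_right)
  also have "(I \<otimes> m) \<cdot> (\<dots>) = \<delta> \<cdot> m"
    using ty0 by (simp add: monoidal_calc \<delta>_alt I_def)
  finally have frob_l: "(I \<otimes> m) \<cdot> (\<delta> \<otimes> I) = \<delta> \<cdot> m" .
  have "(I \<otimes> \<delta>) \<cdot> \<delta> = (I \<otimes> (\<delta> \<cdot> m)) \<cdot> (c \<otimes> I)"
    using ty by (subst (2) \<delta>_alt) (simp add: monoidal_calc whisker_left whisker_right I_def)
  also have "\<dots> = (I \<otimes> m \<otimes> I) \<cdot> ((\<i>\<d> (D \<odot> D) \<otimes> \<delta>) \<cdot> (c \<otimes> I))"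
    unfolding frob_r[symmetric]
    using ty by (simp add: monoidal_calc whisker_left whisker_right I_def flip: tensA_ident)
  also have "(\<i>\<d> (D \<odot> D) \<otimes> \<delta>) \<cdot> (c \<otimes> I) = (c \<otimes> \<i>\<d> (D \<odot> D)) \<cdot> (\<i>\<d> \<one> \<otimes> \<delta>)"
    using ty unfolding I_def by (simp only: slide_left slide_right)
  also have "(I \<otimes> m \<otimes> I) \<cdot> (\<dots>) = (((I \<otimes> m) \<cdot> (c \<otimes> I)) \<otimes> I) \<cdot> \<delta>"
    using ty by (simp add: monoidal_calc whisker_left whisker_right I_def)
  also have "\<dots> = (\<delta> \<otimes> I) \<cdot> \<delta>"
    by (simp flip: \<delta>_alt)
  finally have coassoc: "(\<delta> \<otimes> I) \<cdot> \<delta> = (I \<otimes> \<delta>) \<cdot> \<delta>" ..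
  have counit_l: "(\<epsilon> \<otimes> I) \<cdot> \<delta> = I"
    using zag ty0 by (simp add: monoidal_calc whisker_left whisker_right \<delta>_def I_def)
  have counit_r: "(I \<otimes> \<epsilon>) \<cdot> \<delta> = I"
    using zig ty0 unfolding \<delta>_alt by (simp add: monoidal_calc whisker_left whisker_right I_def)
  show "frobenius_algebra C F"
    by unfold_locales
      (use ty assoc unit_l unit_r coassoc counit_l counit_r frob_l frob_r in
        \<open>auto simp: defs' comult I_def hom_def\<close>)
  have "fcoev C F = ((m \<otimes> I) \<cdot> (I \<otimes> c)) \<cdot> (e \<otimes> \<i>\<d> \<one>)"
    using ty0 by (simp add: fcoev_def comult defs' \<delta>_def I_def monoidal_calc)
  also have "\<dots> = (m \<otimes> I) \<cdot> ((e \<otimes> \<i>\<d> (D \<odot> D)) \<cdot> (\<i>\<d> \<one> \<otimes> c))"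
    using ty0 by (simp add: I_def monoidal_calc slide_left slide_right del: unit_tensA tensA_unit)
  also have "\<dots> = ((m \<cdot> (e \<otimes> I)) \<otimes> I) \<cdot> c"
    using ty0 by (simp add: I_def monoidal_calc whisker_left whisker_right)
  also have "\<dots> = c"
    unfolding unit_l using ty0 by (simp add: I_def monoidal_calc)
  finally show "fcoev C F = c" .
qed

end

section \<open>Frobenius subalgebras and their idempotents\<close>

text \<open>A renaming only: \<open>X\<close> is the ambient algebra, whose Frobenius subalgebras are studied.\<close>
locale ambient_frobenius_algebra = frobenius_algebra C X
  for C :: "('o, 'm, 'x) moncat_scheme" (structure) and X :: "('o, 'm) frob"
begin

abbreviation proj :: "('o, 'm) frob \<times> 'm \<Rightarrow> 'm" where
  "proj \<equiv> bproj C X"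

lemma fdual_hom:
  assumes "frobenius_algebra C G" "frobenius_algebra C H" "f \<in> hom C (fob G) (fob H)"
  shows "fdual C G H f \<in> hom C (fob H) (fob G)"
  unfolding fdual_def
  by (rule dual_mor_hom[OF frobenius_algebra.frobenius_selfdual[OF assms(1)]
        frobenius_algebra.frobenius_selfdual[OF assms(2)] assms(3)])

lemma fdual_comp:
  assumes "frobenius_algebra C F" "frobenius_algebra C G" "frobenius_algebra C H"
    and "f \<in> hom C (fob F) (fob G)" "g \<in> hom C (fob G) (fob H)"
  shows "fdual C F H (g \<cdot> f) = fdual C F G f \<cdot> fdual C G H g"
  unfolding fdual_def
  by (rule dual_mor_comp[OF frobenius_algebra.frobenius_selfdual[OF assms(1)]
        frobenius_algebra.frobenius_selfdual[OF assms(2)]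
        frobenius_algebra.frobenius_selfdual[OF assms(3)] assms(4,5)])

lemma X_frobenius: "frobenius_algebra C X"
  by unfold_locales

lemma frob_subalgebrasD:
  assumes "(G, i) \<in> frob_subalgebras C X"
  shows "frobenius_algebra C G" "i \<in> hom C (fob G) (fob X)" "mono C i"
    "i \<cdot> fmult G = fmult X \<cdot> (i \<otimes> i)" "i \<cdot> funit G = funit X"
    "fdual C X G (fdual C G X i) = i" "fdual C G X i \<cdot> i = \<i>\<d> (fob G)"
    "fdual C G X i \<in> hom C (fob X) (fob G)"
  using assms fdual_hom[OF _ X_frobenius, of G i] by (auto simp: frob_subalgebras_def)

lemma sub_hom: "A \<in> frob_subalgebras C X \<Longrightarrow> snd A \<in> hom C (fob (fst A)) (fob X)"
  and sub_mono: "A \<in> frob_subalgebras C X \<Longrightarrow> mono C (snd A)"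
  using frob_subalgebrasD(2,3)[of "fst A" "snd A"] by simp_all

lemma proj_hom:
  assumes "A \<in> frob_subalgebras C X" shows "proj A \<in> hom C (fob X) (fob X)"
  using comp[OF frob_subalgebrasD(8,2), of "fst A" "snd A"] assms
  by (cases A) (simp add: bproj_def)

text \<open>\<open>(i i\<^sup>*)\<^sup>* = i\<^sup>*\<^sup>* i\<^sup>* = i i\<^sup>*\<close>.\<close>
lemma proj_selfdual:
  assumes "A \<in> frob_subalgebras C X" shows "fdual C X X (proj A) = proj A"
proof -
  obtain G i where A: "A = (G, i)" by force
  note A' = frob_subalgebrasD[OF assms[unfolded A]]
  show ?thesis
    using fdual_comp[OF X_frobenius A'(1) X_frobenius A'(8) A'(2)] A'(6)
    by (simp add: A bproj_def)
qed

lemma frob_subalgebra_self: "(X, \<i>\<d> (fob X)) \<in> frob_subalgebras C X"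
proof -
  have d: "fdual C X X (\<i>\<d> (fob X)) = \<i>\<d> (fob X)"
    unfolding fdual_def by (rule dual_mor_ident[OF frobenius_selfdual])
  have "mono C (\<i>\<d> (fob X))"
    using ident_comp by (fastforce simp: mono_def monoidal_typing frobenius_typing)
  then show ?thesis
    using d frobenius_typing X_frobenius
    by (simp add: frob_subalgebras_def monoidal_calc hom_def)
qed

lemma proj_comp_self:
  assumes "(G, i) \<in> frob_subalgebras C X" shows "proj (G, i) \<cdot> i = i"
  using frob_subalgebrasD[OF assms] comp_ident[of i "fob G" "fob X"]
    comp_assoc[of i "fob G" "fob X" "fdual C G X i" "fob G" i "fob X"]
  by (simp add: bproj_def)

lemma proj_comp_dual:
  assumes "(G, i) \<in> frob_subalgebras C X" shows "fdual C G X i \<cdot> proj (G, i) = fdual C G X i"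
  using frob_subalgebrasD[OF assms] ident_comp[of "fdual C G X i" "fob X" "fob G"]
    comp_assoc[of "fdual C G X i" "fob X" "fob G" i "fob X" "fdual C G X i" "fob G"]
  by (simp add: bproj_def)

text \<open>Inclusion of subobjects of \<open>X\<close>, which turns out to be the order of the idempotents.\<close>
definition sub_le :: "('o, 'm) frob \<times> 'm \<Rightarrow> ('o, 'm) frob \<times> 'm \<Rightarrow> bool" where
  "sub_le A B \<longleftrightarrow> (\<exists>h\<in>hom C (fob (fst A)) (fob (fst B)). snd A = snd B \<cdot> h)"

text \<open>The two equations are dual to each other.\<close>
lemma proj_absorb_dual:
  assumes "A \<in> frob_subalgebras C X" "B \<in> frob_subalgebras C X"
  shows "proj A \<cdot> proj B = proj A \<longleftrightarrow> proj B \<cdot> proj A = proj A"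
proof -
  have "fdual C X X (proj A \<cdot> proj B) = proj B \<cdot> proj A"
    "fdual C X X (proj B \<cdot> proj A) = proj A \<cdot> proj B"
    by (simp_all add: fdual_comp[OF X_frobenius X_frobenius X_frobenius] proj_hom assms proj_selfdual)
  then show ?thesis
    using proj_selfdual[OF assms(1)] by auto
qed

text \<open>An idempotent \<open>b = j j\<^sup>*\<close> with \<open>j\<^sup>* j = id\<close> fixes exactly the morphisms that factor through \<open>j\<close>.\<close>
lemma sub_le_iff:
  assumes "A \<in> frob_subalgebras C X" "B \<in> frob_subalgebras C X"
  shows "sub_le A B \<longleftrightarrow> proj B \<cdot> proj A = proj A"
proof -
  obtain G i H j where AB: "A = (G, i)" "B = (H, j)" by (metis surj_pair)
  note A = frob_subalgebrasD[OF assms(1)[unfolded AB]] and B = frob_subalgebrasD[OF assms(2)[unfolded AB]]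
  let ?p = "fdual C G X i" and ?q = "fdual C H X j"
  note ty = A(2,8) B(2,8) proj_hom[OF assms(1)] proj_hom[OF assms(2)]
  show ?thesis
  proof
    assume "sub_le A B"
    then obtain h where h: "h \<in> hom C (fob G) (fob H)" "i = j \<cdot> h"
      by (auto simp: sub_le_def AB)
    have "proj B \<cdot> i = i"
      using comp_assoc[OF h(1) B(2), of "proj B" "fob X"] ty proj_comp_self[of H j] assms h(2)
      by (simp add: AB)
    then show "proj B \<cdot> proj A = proj A"
      using comp_assoc[OF A(8,2), of "proj B" "fob X"] ty by (simp add: AB bproj_def)
  next
    assume "proj B \<cdot> proj A = proj A"
    then have "proj B \<cdot> i = i"
      using comp_assoc[OF A(2), of "proj A" "fob X" "proj B" "fob X"] ty proj_comp_self[of G i] assms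
      by (simp add: AB)
    then have "i = j \<cdot> (?q \<cdot> i)"
      using comp_assoc[OF A(2) B(8) B(2)] by (simp add: AB bproj_def)
    with comp[OF A(2) B(8)] show "sub_le A B"
      by (auto simp: sub_le_def AB)
  qed
qed

text \<open>If \<open>i i\<^sup>* = j j\<^sup>*\<close>, then \<open>j\<^sup>* i\<close> and \<open>i\<^sup>* j\<close> are the required mutually inverse isomorphisms.\<close>
lemma frob_equiv_iff:
  "(A, B) \<in> frob_equiv C X \<longleftrightarrow>
    A \<in> frob_subalgebras C X \<and> B \<in> frob_subalgebras C X \<and> proj A = proj B"
proof (cases "A \<in> frob_subalgebras C X \<and> B \<in> frob_subalgebras C X")
  case True
  obtain G i H j where AB: "A = (G, i)" "B = (H, j)" by (metis surj_pair)
  have A: "(G, i) \<in> frob_subalgebras C X" and B: "(H, j) \<in> frob_subalgebras C X"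
    using True by (auto simp: AB)
  note A' = frob_subalgebrasD[OF A] and B' = frob_subalgebrasD[OF B]
  let ?p = "fdual C G X i" and ?q = "fdual C H X j"
  show ?thesis
  proof
    assume "(A, B) \<in> frob_equiv C X"
    then obtain f g where fg: "f \<in> hom C (fob G) (fob H)" "g \<in> hom C (fob H) (fob G)"
      "f \<cdot> g = \<i>\<d> (fob H)" "i = j \<cdot> f" "?p = g \<cdot> ?q"
      by (auto simp: frob_equiv_def AB inverse_pair_def)
    have "i \<cdot> ?p = (j \<cdot> f) \<cdot> (g \<cdot> ?q)"
      by (simp flip: fg(4,5))
    also have "\<dots> = j \<cdot> ((f \<cdot> g) \<cdot> ?q)"
      using fg(1,2) B'(2,8) by (simp add: hom_def comp_assoc' Ar_comp Src_comp Tgt_comp)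
    also have "\<dots> = j \<cdot> ?q"
      using ident_comp[OF B'(8)] by (simp add: fg)
    finally show "A \<in> frob_subalgebras C X \<and> B \<in> frob_subalgebras C X \<and> proj A = proj B"
      using True by (simp add: AB bproj_def)
  next
    assume r: "A \<in> frob_subalgebras C X \<and> B \<in> frob_subalgebras C X \<and> proj A = proj B"
    then have eq: "i \<cdot> ?p = j \<cdot> ?q" by (simp add: AB bproj_def)
    have ty: "i \<in> Ar C" "Src C i = fob G" "Tgt C i = fob X" "?p \<in> Ar C" "Src C ?p = fob X" "Tgt C ?p = fob G"
      "j \<in> Ar C" "Src C j = fob H" "Tgt C j = fob X" "?q \<in> Ar C" "Src C ?q = fob X" "Tgt C ?q = fob H"
      using A'(2,8) B'(2,8) by (auto simp: hom_def)
    have 1: "j \<cdot> (?q \<cdot> i) = i"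
      using proj_comp_self[OF A] ty r AB comp_assoc'[of i ?q j] by (simp add: bproj_def)
    have 2: "i \<cdot> (?p \<cdot> j) = j"
      using proj_comp_self[OF B] ty r AB comp_assoc'[of j ?p i] by (simp add: bproj_def)
    have 3: "(?p \<cdot> j) \<cdot> ?q = ?p"
      using proj_comp_dual[OF A] ty r AB comp_assoc'[of ?q j ?p] by (simp add: bproj_def)
    have 4: "(?p \<cdot> j) \<cdot> (?q \<cdot> i) = \<i>\<d> (fob G)"
      using 1 A'(7) ty by (simp add: comp_assoc' Ar_comp Src_comp Tgt_comp)
    have 5: "(?q \<cdot> i) \<cdot> (?p \<cdot> j) = \<i>\<d> (fob H)"
      using 2 B'(7) ty by (simp add: comp_assoc' Ar_comp Src_comp Tgt_comp)
    have "inverse_pair C (fob G) (fob H) (?q \<cdot> i) (?p \<cdot> j)"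
      using 4 5 ty by (simp add: inverse_pair_def hom_def Ar_comp Src_comp Tgt_comp)
    with A B 1[symmetric] 3[symmetric] show "(A, B) \<in> frob_equiv C X"
      unfolding frob_equiv_def AB by blast
  qed
qed (auto simp: frob_equiv_def)

lemma equiv_frob_equiv: "equiv (frob_subalgebras C X) (frob_equiv C X)"
  by (rule equivI) (auto simp: refl_on_def sym_def trans_def frob_equiv_iff)

lemma frob_classesE:
  assumes "\<alpha> \<in> frob_classes C X"
  obtains A where "A \<in> frob_subalgebras C X" "\<alpha> = frob_class C X A" "A \<in> \<alpha>"
proof -
  obtain A where A: "A \<in> frob_subalgebras C X" "\<alpha> = frob_class C X A"
    using assms by (auto simp: frob_classes_def quotient_def)
  then have "A \<in> \<alpha>" by (simp add: frob_equiv_iff)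
  with A show ?thesis by (rule that)
qed

lemma frob_class_in_classes: "A \<in> frob_subalgebras C X \<Longrightarrow> frob_class C X A \<in> frob_classes C X"
  by (auto simp: frob_classes_def intro: quotientI)

lemma frob_class_of_member:
  assumes "\<alpha> \<in> frob_classes C X" "A \<in> \<alpha>"
  shows "A \<in> frob_subalgebras C X" "\<alpha> = frob_class C X A"
  using assms by (auto simp: frob_equiv_iff elim!: frob_classesE)

text \<open>The order of classes can be tested on any representatives, as these enter only through their
  idempotents.\<close>
lemma frob_le_class:
  assumes "\<alpha> \<in> frob_classes C X" "\<beta> \<in> frob_classes C X" "A \<in> \<alpha>" "B \<in> \<beta>"
  shows "frob_le C X \<alpha> \<beta> \<longleftrightarrow> sub_le A B"
proof -
  note A = frob_class_of_member[OF assms(1,3)] and B = frob_class_of_member[OF assms(2,4)]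
  have \<alpha>: "proj A' = proj A" if "A' \<in> \<alpha>" for A'
    using that A(2) by (auto simp: frob_equiv_iff)
  have \<beta>: "proj B' = proj B" if "B' \<in> \<beta>" for B'
    using that B(2) by (auto simp: frob_equiv_iff)
  have "frob_le C X \<alpha> \<beta> \<longleftrightarrow> proj A \<cdot> proj B = proj A \<and> proj B \<cdot> proj A = proj A"
  proof
    assume "frob_le C X \<alpha> \<beta>"
    then obtain A' B' where "A' \<in> \<alpha>" "B' \<in> \<beta>"
      and le: "proj A' \<cdot> proj B' = proj A'" "proj B' \<cdot> proj A' = proj A'"
      unfolding frob_le_def by blast
    then show "proj A \<cdot> proj B = proj A \<and> proj B \<cdot> proj A = proj A"
      using \<alpha>[of A'] \<beta>[of B'] by simp
  next
    assume "proj A \<cdot> proj B = proj A \<and> proj B \<cdot> proj A = proj A"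
    then show "frob_le C X \<alpha> \<beta>"
      using assms(3,4) unfolding frob_le_def by blast
  qed
  also have "\<dots> \<longleftrightarrow> sub_le A B"
    using sub_le_iff[OF A(1) B(1)] proj_absorb_dual[OF A(1) B(1)] by blast
  finally show ?thesis .
qed

text \<open>Mutually contained selfdual idempotents are equal: \<open>b = b b' = b'\<close>.\<close>
lemma frob_class_eqI:
  assumes "A \<in> frob_subalgebras C X" "B \<in> frob_subalgebras C X" "sub_le A B" "sub_le B A"
  shows "frob_class C X A = frob_class C X B"
proof -
  have "proj A \<cdot> proj B = proj A"
    using assms(3) sub_le_iff[OF assms(1,2)] proj_absorb_dual[OF assms(1,2)] by blast
  moreover have "proj A \<cdot> proj B = proj B"
    using assms(4) sub_le_iff[OF assms(2,1)] by blast
  ultimately have "proj A = proj B" by (rule trans[OF sym])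
  with assms(1,2) have "(A, B) \<in> frob_equiv C X" by (simp add: frob_equiv_iff)
  then show ?thesis by (rule equiv_class_eq[OF equiv_frob_equiv])
qed

lemma sub_le_refl: "A \<in> frob_subalgebras C X \<Longrightarrow> sub_le A A"
  and sub_le_trans: "\<lbrakk>A \<in> frob_subalgebras C X; B \<in> frob_subalgebras C X; D \<in> frob_subalgebras C X;
    sub_le A B; sub_le B D\<rbrakk> \<Longrightarrow> sub_le A D"
proof -
  assume "A \<in> frob_subalgebras C X"
  then show "sub_le A A"
    using frob_subalgebrasD(1,2)[of "fst A" "snd A"] frobenius_algebra.fob[of C "fst A"]
      ident[of "fob (fst A)"] comp_ident[of "snd A"]
    by (force simp: sub_le_def)
next
  assume D: "D \<in> frob_subalgebras C X" and "sub_le A B" "sub_le B D"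
  then obtain g h where gh: "g \<in> hom C (fob (fst A)) (fob (fst B))" "snd A = snd B \<cdot> g"
    "h \<in> hom C (fob (fst B)) (fob (fst D))" "snd B = snd D \<cdot> h"
    by (auto simp: sub_le_def)
  then have "snd A = snd D \<cdot> (h \<cdot> g)"
    using comp_assoc[OF gh(1,3)] frob_subalgebrasD(2)[of "fst D" "snd D"] D by auto
  then show "sub_le A D"
    using comp[OF gh(1,3)] by (auto simp: sub_le_def)
qed

lemma frob_subposet_partial_order:
  assumes "L \<subseteq> frob_classes C X"
  shows "partial_order (frob_subposet C X L)"
proof -
  have le: "frob_le C X \<alpha> \<beta> \<longleftrightarrow> sub_le A B" if "\<alpha> \<in> L" "\<beta> \<in> L" "A \<in> \<alpha>" "B \<in> \<beta>" for \<alpha> \<beta> A B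
    using frob_le_class that assms by blast
  have sub: "A \<in> frob_subalgebras C X" "\<alpha> = frob_class C X A" if "\<alpha> \<in> L" "A \<in> \<alpha>" for \<alpha> A
    using frob_class_of_member that assms by blast+
  have ex: "\<exists>A. A \<in> \<alpha>" if "\<alpha> \<in> L" for \<alpha>
    using frob_classesE that assms by blast
  show ?thesis
  proof (unfold_locales, simp_all add: frob_subposet_def)
    fix x assume "x \<in> L"
    then show "frob_le C X x x" using ex le sub(1) sub_le_refl by blast
  next
    fix x y assume xy: "frob_le C X x y" "frob_le C X y x" "x \<in> L" "y \<in> L"
    obtain A B where AB: "A \<in> x" "B \<in> y" using ex[OF xy(3)] ex[OF xy(4)] by blast
    have "sub_le A B" "sub_le B A"
      using xy(1,2) le[OF xy(3,4) AB] le[OF xy(4,3) AB(2,1)] by simp_all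
    then have "frob_class C X A = frob_class C X B"
      by (rule frob_class_eqI[OF sub(1)[OF xy(3) AB(1)] sub(1)[OF xy(4) AB(2)]])
    then show "x = y" using sub(2)[OF xy(3) AB(1)] sub(2)[OF xy(4) AB(2)] by simp
  next
    fix x y z assume xyz: "frob_le C X x y" "frob_le C X y z" "x \<in> L" "y \<in> L" "z \<in> L"
    obtain A B D where ABD: "A \<in> x" "B \<in> y" "D \<in> z"
      using ex[OF xyz(3)] ex[OF xyz(4)] ex[OF xyz(5)] by blast
    have "sub_le A B" "sub_le B D"
      using xyz(1,2) le[OF xyz(3,4) ABD(1,2)] le[OF xyz(4,5) ABD(2,3)] by simp_all
    then have "sub_le A D"
      by (rule sub_le_trans[OF sub(1)[OF xyz(3) ABD(1)] sub(1)[OF xyz(4) ABD(2)]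
            sub(1)[OF xyz(5) ABD(3)]])
    then show "frob_le C X x z" using le[OF xyz(3,5) ABD(1,3)] by simp
  qed
qed

lemma intersection_sub_le:
  assumes A: "A \<in> frob_subalgebras C X" and B: "B \<in> frob_subalgebras C X"
    and F: "F \<in> frob_subalgebras C X" and I: "frob_intersection C (fob (fst F)) (snd F) A B"
  shows "sub_le F A" "sub_le F B"
    "\<lbrakk>G \<in> frob_subalgebras C X; sub_le G A; sub_le G B\<rbrakk> \<Longrightarrow> sub_le G F"
proof -
  obtain f g where fg: "f \<in> hom C (fob (fst F)) (fob (fst A))" "g \<in> hom C (fob (fst F)) (fob (fst B))"
    "snd F = snd A \<cdot> f" "snd F = snd B \<cdot> g"
    by (rule is_intersectionE[OF I sub_hom[OF A] sub_hom[OF B]]) (rule that)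
  show "sub_le F A" "sub_le F B"
    unfolding sub_le_def by (rule bexI[of _ f], fact+) (rule bexI[of _ g], fact+)
  assume G: "G \<in> frob_subalgebras C X" "sub_le G A" "sub_le G B"
  then obtain s t where st: "s \<in> hom C (fob (fst G)) (fob (fst A))" "snd G = snd A \<cdot> s"
    "t \<in> hom C (fob (fst G)) (fob (fst B))" "snd G = snd B \<cdot> t"
    unfolding sub_le_def by (elim bexE) (rule that)
  obtain u where u: "u \<in> hom C (fob (fst G)) (fob (fst F))" "snd F \<cdot> u = snd A \<cdot> s"
    by (rule intersection_factor[OF I sub_hom[OF A] sub_hom[OF B] st(1,3) trans[OF st(2)[symmetric] st(4)]])
  have "snd G = snd F \<cdot> u" using trans[OF st(2) u(2)[symmetric]] .
  then show "sub_le G F" unfolding sub_le_def by (rule bexI) (fact u(1))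
qed

end

section \<open>Frobenius structure on a selfdual subalgebra\<close>

context ambient_frobenius_algebra
begin

text \<open>Selfduality of \<open>b = j p\<close> lets \<open>b\<close> pass from one leg of \<open>ev\<close> to the other, where it is absorbed by
  \<open>j\<close>. This gives \<open>ev (b \<otimes> j) = ev (id \<otimes> j)\<close> and its mirror image, from which the zigzag identities
  for the restricted form as well as \<open>j\<^sup>* = p\<close> and \<open>p\<^sup>* = j\<close> follow.\<close>
lemma selfdual_subalgebra_frobenius:
  assumes j: "j \<in> hom C D (fob X)" and p: "p \<in> hom C (fob X) D" and D: "D \<in> Ob C"
    and pj: "p \<cdot> j = \<i>\<d> D"
    and selfdual: "fdual C X X (j \<cdot> p) = j \<cdot> p"
    and m: "m \<in> hom C (D \<odot> D) D" and jm: "j \<cdot> m = fmult X \<cdot> (j \<otimes> j)"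
    and e: "e \<in> hom C \<one> D" and je: "j \<cdot> e = funit X"
  shows "\<exists>F. fob F = D \<and> (F, j) \<in> frob_subalgebras C X"
proof -
  define Y where "Y = fob X"
  define I where "I = \<i>\<d> D"
  define J where "J = \<i>\<d> Y"
  define ev where "ev = fev C X"
  define coev where "coev = fcoev C X"
  define b where "b = j \<cdot> p"
  define c where "c = (p \<otimes> p) \<cdot> coev"
  define F where "F = \<lparr>fob = D, fmult = m, fcomult = (m \<otimes> I) \<cdot> (I \<otimes> c), funit = e,
    fcounit = fcounit X \<cdot> j\<rparr>"
  note Xd = frobenius_selfdual[folded Y_def ev_def coev_def]
  have ty: "Y \<in> Ob C" "D \<in> Ob C" "j \<in> Ar C" "Src C j = D" "Tgt C j = Y"
    "p \<in> Ar C" "Src C p = Y" "Tgt C p = D" "m \<in> Ar C" "Src C m = D \<odot> D" "Tgt C m = D"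
    "e \<in> Ar C" "Src C e = \<one>" "Tgt C e = D"
    using assms frobenius_typing by (auto simp: hom_def Y_def)
  have "b \<in> Ar C" "Src C b = Y" "Tgt C b = Y" "I \<in> Ar C" "Src C I = D" "Tgt C I = D"
    "J \<in> Ar C" "Src C J = Y" "Tgt C J = Y"
    using ty by (simp_all add: b_def I_def J_def monoidal_typing)
  note ty = ty this is_left_dualD(1-8)[OF Xd] frobenius_typing[folded Y_def]
  have pj: "p \<cdot> j = I" using pj by (simp add: I_def)
  have bj: "b \<cdot> j = j"
    using ty pj by (simp add: b_def monoidal_calc I_def)
  have cancel: "u = v" if eq: "j \<cdot> u = j \<cdot> v" and u: "u \<in> hom C T D" and v: "v \<in> hom C T D" for u v T
  proof -
    have "p \<cdot> (j \<cdot> w) = w" if "w \<in> hom C T D" for w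
      using comp_assoc[OF that j p] ident_comp[OF that] by (simp add: pj I_def)
    from this[OF u] this[OF v] eq show ?thesis by metis
  qed
  \<comment> \<open>The equation \<open>b\<^sup>* = b\<close> says that \<open>b\<close> is its own adjoint for the form.\<close>
  have b_adj: "ev \<cdot> (b \<otimes> J) = ev \<cdot> (J \<otimes> b)"
  proof -
    have "dual_mor C Y coev Y ev b = b"
      using selfdual by (simp add: fdual_def b_def Y_def ev_def coev_def)
    then show ?thesis
      using ev_dual_mor[OF Xd Xd, of b] ty by (simp add: hom_def J_def)
  qed
  have ev_bj: "ev \<cdot> (b \<otimes> j) = ev \<cdot> (J \<otimes> j)"
  proof -
    have "ev \<cdot> (b \<otimes> j) = (ev \<cdot> (b \<otimes> J)) \<cdot> (J \<otimes> j)"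
      using ty by (simp add: monoidal_calc interchange J_def)
    also have "\<dots> = ev \<cdot> (J \<otimes> (b \<cdot> j))"
      unfolding b_adj using ty by (simp add: monoidal_calc interchange J_def)
    finally show ?thesis by (simp add: bj)
  qed
  have ev_jb: "ev \<cdot> (j \<otimes> b) = ev \<cdot> (j \<otimes> J)"
  proof -
    have "ev \<cdot> (j \<otimes> b) = (ev \<cdot> (J \<otimes> b)) \<cdot> (j \<otimes> J)"
      using ty by (simp add: monoidal_calc interchange J_def)
    also have "\<dots> = ev \<cdot> ((b \<cdot> j) \<otimes> J)"
      unfolding b_adj[symmetric] using ty by (simp add: monoidal_calc interchange J_def)
    finally show ?thesis by (simp add: bj)
  qed
  have ev_F: "(fcounit X \<cdot> j) \<cdot> m = ev \<cdot> (j \<otimes> j)"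
    using ty jm by (simp add: monoidal_calc ev_def fev_def)
  have zig: "(I \<otimes> (ev \<cdot> (j \<otimes> j))) \<cdot> (c \<otimes> I) = I"
  proof -
    have "(I \<otimes> (ev \<cdot> (j \<otimes> j))) \<cdot> (c \<otimes> I)
        = ((I \<otimes> (ev \<cdot> (j \<otimes> j))) \<cdot> (p \<otimes> (p \<otimes> I))) \<cdot> (coev \<otimes> I)"
      using ty by (simp add: monoidal_calc whisker_right c_def I_def)
    also have "(I \<otimes> (ev \<cdot> (j \<otimes> j))) \<cdot> (p \<otimes> (p \<otimes> I)) = p \<otimes> (ev \<cdot> (b \<otimes> j))"
      using ty by (simp add: monoidal_calc interchange b_def I_def)
    also have "\<dots> = p \<cdot> ((J \<otimes> ev) \<cdot> (\<i>\<d> (Y \<odot> Y) \<otimes> j))"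
      using ty interchange[of J p "ev \<cdot> (J \<otimes> j)" "\<i>\<d> \<one>"]
      by (simp add: monoidal_calc whisker_left J_def ev_bj flip: tensA_ident)
    also have "(\<dots>) \<cdot> (coev \<otimes> I) = p \<cdot> ((J \<otimes> ev) \<cdot> ((\<i>\<d> (Y \<odot> Y) \<otimes> j) \<cdot> (coev \<otimes> I)))"
      using ty by (simp add: monoidal_typing comp_assoc')
    also have "(\<i>\<d> (Y \<odot> Y) \<otimes> j) \<cdot> (coev \<otimes> I) = (coev \<otimes> J) \<cdot> (\<i>\<d> \<one> \<otimes> j)"
      using ty unfolding I_def J_def by (simp only: slide_left slide_right)
    also have "p \<cdot> ((J \<otimes> ev) \<cdot> (\<dots>)) = p \<cdot> (((J \<otimes> ev) \<cdot> (coev \<otimes> J)) \<cdot> j)"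
      using ty by (simp add: monoidal_calc J_def)
    also have "\<dots> = I"
      using is_left_dualD(9)[OF Xd] ty pj by (simp add: J_def ident_comp')
    finally show ?thesis .
  qed
  have zag: "((ev \<cdot> (j \<otimes> j)) \<otimes> I) \<cdot> (I \<otimes> c) = I"
  proof -
    have "((ev \<cdot> (j \<otimes> j)) \<otimes> I) \<cdot> (I \<otimes> c)
        = (((ev \<cdot> (j \<otimes> j)) \<otimes> I) \<cdot> ((I \<otimes> p) \<otimes> p)) \<cdot> (I \<otimes> coev)"
      using ty by (simp add: monoidal_calc whisker_left c_def I_def)
    also have "((ev \<cdot> (j \<otimes> j)) \<otimes> I) \<cdot> ((I \<otimes> p) \<otimes> p) = (ev \<cdot> (j \<otimes> b)) \<otimes> p"
      using ty interchange[of "I \<otimes> p" "ev \<cdot> (j \<otimes> j)" p I] interchange[of I j p j]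
      by (simp add: comp_assoc' Ar_tens Src_tens Tgt_tens Ar_comp Src_comp Tgt_comp
          comp_ident' ident_comp' b_def I_def)
    also have "\<dots> = p \<cdot> ((ev \<otimes> J) \<cdot> (j \<otimes> \<i>\<d> (Y \<odot> Y)))"
      using ty interchange[of "ev \<cdot> (j \<otimes> J)" "\<i>\<d> \<one>" J p]
      by (simp add: monoidal_calc whisker_right J_def ev_jb)
    also have "(\<dots>) \<cdot> (I \<otimes> coev) = p \<cdot> ((ev \<otimes> J) \<cdot> ((j \<otimes> \<i>\<d> (Y \<odot> Y)) \<cdot> (I \<otimes> coev)))"
      using ty by (simp add: monoidal_typing comp_assoc')
    also have "(j \<otimes> \<i>\<d> (Y \<odot> Y)) \<cdot> (I \<otimes> coev) = (J \<otimes> coev) \<cdot> (j \<otimes> \<i>\<d> \<one>)"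
      using ty unfolding I_def J_def by (simp only: slide_left slide_right)
    also have "p \<cdot> ((ev \<otimes> J) \<cdot> (\<dots>)) = p \<cdot> (((ev \<otimes> J) \<cdot> (J \<otimes> coev)) \<cdot> j)"
      using ty by (simp add: monoidal_calc J_def)
    also have "\<dots> = I"
      using is_left_dualD(10)[OF Xd] ty pj by (simp add: J_def ident_comp')
    finally show ?thesis .
  qed
  have dual: "is_left_dual C D D (ev \<cdot> (j \<otimes> j)) c"
    using ty zig zag by (simp add: is_left_dual_def hom_def monoidal_typing c_def I_def)
  \<comment> \<open>The algebra laws hold after the monomorphism \<open>j\<close>, where they are those of \<open>X\<close>.\<close>
  have assoc: "m \<cdot> (m \<otimes> I) = m \<cdot> (I \<otimes> m)"
  proof (rule cancel)
    have "j \<cdot> (m \<cdot> (m \<otimes> I)) = (j \<cdot> m) \<cdot> (m \<otimes> I)"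
      using ty by (simp add: monoidal_typing comp_assoc')
    also have "\<dots> = fmult X \<cdot> ((fmult X \<cdot> (j \<otimes> j)) \<otimes> j)"
      using ty jm by (simp add: monoidal_calc interchange I_def)
    also have "\<dots> = (fmult X \<cdot> (fmult X \<otimes> J)) \<cdot> (j \<otimes> (j \<otimes> j))"
      using ty interchange[of "j \<otimes> j" "fmult X" j J] by (simp add: monoidal_calc J_def)
    also have "\<dots> = (fmult X \<cdot> (J \<otimes> fmult X)) \<cdot> (j \<otimes> (j \<otimes> j))"
      using fmult_assoc by (simp add: J_def Y_def)
    also have "\<dots> = fmult X \<cdot> (j \<otimes> (j \<cdot> m))"
      unfolding jm using ty by (simp add: monoidal_calc interchange J_def)
    also have "\<dots> = (j \<cdot> m) \<cdot> (I \<otimes> m)"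
      using ty jm by (simp add: monoidal_calc interchange I_def)
    also have "\<dots> = j \<cdot> (m \<cdot> (I \<otimes> m))"
      using ty by (simp add: monoidal_typing comp_assoc')
    finally show "j \<cdot> (m \<cdot> (m \<otimes> I)) = j \<cdot> (m \<cdot> (I \<otimes> m))" .
    show "m \<cdot> (m \<otimes> I) \<in> hom C (D \<odot> (D \<odot> D)) D" "m \<cdot> (I \<otimes> m) \<in> hom C (D \<odot> (D \<odot> D)) D"
      using ty by (simp_all add: hom_def monoidal_typing)
  qed
  have unit_l: "m \<cdot> (e \<otimes> I) = I"
  proof (rule cancel)
    have "j \<cdot> (m \<cdot> (e \<otimes> I)) = (j \<cdot> m) \<cdot> (e \<otimes> I)"
      using ty by (simp add: monoidal_typing comp_assoc')
    also have "\<dots> = fmult X \<cdot> ((funit X \<otimes> J) \<cdot> (\<i>\<d> \<one> \<otimes> j))"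
      using ty jm je interchange[of "\<i>\<d> \<one>" "funit X" j J]
      by (simp add: monoidal_calc interchange I_def J_def)
    also have "\<dots> = (fmult X \<cdot> (funit X \<otimes> J)) \<cdot> j"
      using ty by (simp add: monoidal_calc J_def)
    also have "\<dots> = j \<cdot> I"
      using funit_left ty by (simp add: J_def I_def Y_def ident_comp' comp_ident')
    finally show "j \<cdot> (m \<cdot> (e \<otimes> I)) = j \<cdot> I" .
    show "m \<cdot> (e \<otimes> I) \<in> hom C D D" "I \<in> hom C D D"
      using ty by (simp_all add: hom_def monoidal_typing)
  qed
  have unit_r: "m \<cdot> (I \<otimes> e) = I"
  proof (rule cancel)
    have "j \<cdot> (m \<cdot> (I \<otimes> e)) = (j \<cdot> m) \<cdot> (I \<otimes> e)"
      using ty by (simp add: monoidal_typing comp_assoc')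
    also have "\<dots> = fmult X \<cdot> ((J \<otimes> funit X) \<cdot> (j \<otimes> \<i>\<d> \<one>))"
      using ty jm je interchange[of j J "\<i>\<d> \<one>" "funit X"]
      by (simp add: monoidal_calc interchange I_def J_def)
    also have "\<dots> = (fmult X \<cdot> (J \<otimes> funit X)) \<cdot> j"
      using ty by (simp add: monoidal_calc J_def)
    also have "\<dots> = j \<cdot> I"
      using funit_right ty by (simp add: J_def I_def Y_def ident_comp' comp_ident')
    finally show "j \<cdot> (m \<cdot> (I \<otimes> e)) = j \<cdot> I" .
    show "m \<cdot> (I \<otimes> e) \<in> hom C D D" "I \<in> hom C D D"
      using ty by (simp_all add: hom_def monoidal_typing)
  qed
  have F: "frobenius_algebra C F" "fcoev C F = c"
    using frobenius_algebra_of_nondegenerate_form[of F c] dual assoc unit_l unit_r ty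
    by (simp_all add: F_def I_def ev_F hom_def monoidal_typing)
  have ev_F': "fev C F = ev \<cdot> (j \<otimes> j)"
    by (simp add: fev_def F_def ev_F)
  have dual_j: "fdual C F X j = p"
    unfolding fdual_def F ev_F' using p[folded Y_def] j[folded Y_def]
  proof (simp add: F_def Y_def[symmetric] ev_def[symmetric], intro dual_mor_unique[OF dual Xd])
    show "(ev \<cdot> (j \<otimes> j)) \<cdot> (p \<otimes> \<i>\<d> D) = ev \<cdot> (\<i>\<d> Y \<otimes> j)"
      using ty ev_bj by (simp add: monoidal_calc interchange b_def I_def J_def)
  qed
  have dual_p: "fdual C X F p = j"
    unfolding fdual_def F ev_F' using p[folded Y_def] j[folded Y_def]
  proof (simp add: F_def Y_def[symmetric] ev_def[symmetric] coev_def[symmetric],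
      intro dual_mor_unique[OF Xd dual])
    show "ev \<cdot> (j \<otimes> \<i>\<d> Y) = (ev \<cdot> (j \<otimes> j)) \<cdot> (\<i>\<d> D \<otimes> p)"
      using ty ev_jb by (simp add: monoidal_calc interchange b_def I_def J_def)
  qed
  have "mono C j"
    unfolding mono_def ty(4) by (intro conjI ballI allI impI ty(3)) (rule cancel)
  then have "(F, j) \<in> frob_subalgebras C X"
    using F(1) j jm je dual_j dual_p pj
    by (simp add: frob_subalgebras_def F_def I_def)
  then show ?thesis by (intro exI[of _ F]) (simp add: F_def)
qed

text \<open>The product of two elements of the intersection lies in both subalgebras, hence in the
  intersection, and so does the unit.\<close>
lemma selfdual_intersection_frobenius:
  assumes A: "A \<in> frob_subalgebras C X" and B: "B \<in> frob_subalgebras C X"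
    and I: "frob_intersection C D j A B"
    and sd: "ambiently_selfdual C (fob X) (fev C X) (fcoev C X) D j"
  obtains F where "F \<in> frob_subalgebras C X" "fob (fst F) = D" "snd F = j"
proof -
  obtain G a H b where AB: "A = (G, a)" "B = (H, b)" by (metis surj_pair)
  note A' = frob_subalgebrasD[OF A[unfolded AB]] and B' = frob_subalgebrasD[OF B[unfolded AB]]
  note I = I[unfolded AB snd_conv]
  interpret G: frobenius_algebra C G by (rule A')
  interpret H: frobenius_algebra C H by (rule B')
  obtain f g where fg: "f \<in> hom C D (fob G)" "g \<in> hom C D (fob H)" "j = a \<cdot> f" "j = b \<cdot> g"
    using is_intersectionE[OF I A'(2) B'(2)] by blast
  obtain p where p: "split_subobject C (fob X) D j p" "fdual C X X (j \<cdot> p) = j \<cdot> p"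
    using sd by (auto simp: ambiently_selfdual_def is_ambient_dual_def fdual_def)
  have product: "fmult X \<cdot> (j \<otimes> j) = i \<cdot> (fmult K \<cdot> (h \<otimes> h))"
    if K: "(K, i) \<in> frob_subalgebras C X" and h: "h \<in> hom C D (fob K)" "j = i \<cdot> h" for K i h
  proof -
    interpret K: frobenius_algebra C K by (rule frob_subalgebrasD[OF K])
    note i = frob_subalgebrasD(2)[OF K]
    have "fmult X \<cdot> (j \<otimes> j) = fmult X \<cdot> ((i \<otimes> i) \<cdot> (h \<otimes> h))"
      unfolding h(2) by (simp only: tensA_comp[OF h(1) i h(1) i])
    also have "\<dots> = (i \<cdot> fmult K) \<cdot> (h \<otimes> h)"
      unfolding frob_subalgebrasD(4)[OF K] by (rule comp_assoc[OF tensA[OF h(1) h(1)] tensA[OF i i] fmult, symmetric])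
    also have "\<dots> = i \<cdot> (fmult K \<cdot> (h \<otimes> h))"
      by (rule comp_assoc[OF tensA[OF h(1) h(1)] K.fmult i])
    finally show ?thesis .
  qed
  note pa = product[OF A[unfolded AB] fg(1,3)] and pb = product[OF B[unfolded AB] fg(2,4)]
  obtain m where m: "m \<in> hom C (D \<odot> D) D" "j \<cdot> m = fmult X \<cdot> (j \<otimes> j)"
    using intersection_factor[OF I A'(2) B'(2) comp[OF tensA[OF fg(1,1)] G.fmult]
        comp[OF tensA[OF fg(2,2)] H.fmult]] pa pb by auto
  obtain e where e: "e \<in> hom C \<one> D" "j \<cdot> e = funit X"
    using intersection_factor[OF I A'(2) B'(2) G.funit H.funit] A'(5) B'(5) by auto
  show ?thesis
    using selfdual_subalgebra_frobenius[of j D p m e] p m e that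
    by (auto simp: split_subobject_def)
qed

text \<open>An intersection is unique up to isomorphism of subobjects. Transporting the retraction \<open>i\<^sup>*\<close> of the
  Frobenius subalgebra along \<open>v\<close> leaves its idempotent \<open>i i\<^sup>*\<close> unchanged.\<close>
lemma frobenius_intersection_selfdual:
  assumes A: "A \<in> frob_subalgebras C X" and B: "B \<in> frob_subalgebras C X"
    and F: "F \<in> frob_subalgebras C X"
    and IF: "frob_intersection C (fob (fst F)) (snd F) A B"
    and I: "frob_intersection C D j A B"
  shows "ambiently_selfdual C (fob X) (fev C X) (fcoev C X) D j"
proof -
  obtain G i where Gi: "F = (G, i)" by force
  note Fd = frob_subalgebrasD[OF F[unfolded Gi]] and IF = IF[unfolded Gi fst_conv snd_conv]
  let ?p = "fdual C G X i"
  note a = sub_mono[OF A] sub_hom[OF A] and b = sub_mono[OF B] sub_hom[OF B]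
  obtain f g where fg: "f \<in> hom C D (fob (fst A))" "g \<in> hom C D (fob (fst B))"
    "j = snd A \<cdot> f" "j = snd B \<cdot> g"
    using is_intersectionE[OF I a(2) b(2)] by blast
  obtain f' g' where fg': "f' \<in> hom C (fob G) (fob (fst A))" "g' \<in> hom C (fob G) (fob (fst B))"
    "i = snd A \<cdot> f'" "i = snd B \<cdot> g'"
    using is_intersectionE[OF IF a(2) b(2)] by blast
  have eq: "snd A \<cdot> f = snd B \<cdot> g" "snd A \<cdot> f' = snd B \<cdot> g'"
    using fg(3,4) fg'(3,4) by simp_all
  obtain u where u: "u \<in> hom C D (fob G)" "i \<cdot> u = j"
    using intersection_factor[OF IF a(2) b(2) fg(1,2) eq(1)] fg(3) by metis
  obtain v where v: "v \<in> hom C (fob G) D" "j \<cdot> v = i"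
    using intersection_factor[OF I a(2) b(2) fg'(1,2) eq(2)] fg'(3) by metis
  have j: "j \<in> hom C D (fob X)" "mono C j"
    using comp[OF fg(1) a(2)] fg(3) intersection_mono[OF I a b] by simp_all
  have D: "D \<in> Ob C" by (rule hom_Ob(1)[OF j(1)])
  have jvp: "j \<cdot> (v \<cdot> ?p) = i \<cdot> ?p"
    using comp_assoc[OF Fd(8) v(1) j(1)] v(2) by simp
  have "j \<cdot> (v \<cdot> u) = j \<cdot> \<i>\<d> D"
    using comp_assoc[OF u(1) v(1) j(1)] u(2) v(2) comp_ident[OF j(1)] by simp
  then have "v \<cdot> u = \<i>\<d> D"
    by (rule monoD[OF j(2,1) comp[OF u(1) v(1)] ident[OF D]])
  moreover have "?p \<cdot> j = u"
    using comp_assoc[OF u(1) Fd(2,8)] u(2) Fd(7) ident_comp[OF u(1)] by simp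
  ultimately have "(v \<cdot> ?p) \<cdot> j = \<i>\<d> D"
    using comp_assoc[OF j(1) Fd(8) v(1)] by simp
  then have split: "split_subobject C (fob X) D j (v \<cdot> ?p)"
    using D j(1) comp[OF Fd(8) v(1)] by (simp add: split_subobject_def)
  have "fdual C X X (j \<cdot> (v \<cdot> ?p)) = j \<cdot> (v \<cdot> ?p)"
    using proj_selfdual[OF F] by (simp add: jvp Gi bproj_def)
  with split show ?thesis
    unfolding ambiently_selfdual_def is_ambient_dual_def fdual_def by blast
qed

end

section \<open>Monomorphisms and simple objects in an abelian category\<close>

context category
begin

text \<open>Two zero objects are connected by a unique morphism, which compares the two factorizations.\<close>
lemma zero_mor_unique:
  assumes "zero_mor C A B f" "zero_mor C A B g" shows "f = g"
proof -
  obtain Z f1 f2 where f: "zero_object C Z" "f1 \<in> hom C A Z" "f2 \<in> hom C Z B" "f = f2 \<cdot> f1"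
    using assms(1) unfolding zero_mor_def by blast
  obtain Z' g1 g2 where g: "zero_object C Z'" "g1 \<in> hom C A Z'" "g2 \<in> hom C Z' B" "g = g2 \<cdot> g1"
    using assms(2) unfolding zero_mor_def by blast
  have "Z \<in> Ob C" using f(1) by (simp add: zero_object_def)
  then obtain k where k: "k \<in> hom C Z Z'"
    using g(1) unfolding zero_object_def by blast
  have "k \<cdot> f1 = g1"
    using g(1,2) comp[OF f(2) k] hom_Ob(1)[OF f(2)] unfolding zero_object_def by blast
  moreover have "g2 \<cdot> k = f2"
    using f(1,3) comp[OF k g(3)] hom_Ob(2)[OF f(3)] unfolding zero_object_def by blast
  ultimately show "f = g"
    using comp_assoc[OF f(2) k g(3)] f(4) g(4) by simp
qed

lemma zero_mor_comp:
  assumes "zero_mor C A B f" "g \<in> hom C B D" shows "zero_mor C A D (g \<cdot> f)"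
proof -
  obtain Z f1 f2 where f: "zero_object C Z" "f1 \<in> hom C A Z" "f2 \<in> hom C Z B" "f = f2 \<cdot> f1"
    using assms(1) unfolding zero_mor_def by blast
  have "g \<cdot> f = (g \<cdot> f2) \<cdot> f1"
    by (simp add: f(4) comp_assoc[OF f(2,3) assms(2)])
  with f(1,2) comp[OF f(3) assms(2)] show ?thesis
    unfolding zero_mor_def by blast
qed

lemma comp_zero_mor:
  assumes "zero_mor C B D g" "f \<in> hom C A B" shows "zero_mor C A D (g \<cdot> f)"
proof -
  obtain Z g1 g2 where g: "zero_object C Z" "g1 \<in> hom C B Z" "g2 \<in> hom C Z D" "g = g2 \<cdot> g1"
    using assms(1) unfolding zero_mor_def by blast
  have "g \<cdot> f = g2 \<cdot> (g1 \<cdot> f)"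
    by (simp add: g(4) comp_assoc[OF assms(2) g(2,3)])
  with g(1,3) comp[OF assms(2) g(2)] show ?thesis
    unfolding zero_mor_def by blast
qed

lemma kernelD:
  assumes "is_kernel C K k f" "f \<in> hom C A B"
  shows "k \<in> hom C K A" "zero_mor C K B (f \<cdot> k)"
    "\<lbrakk>g \<in> hom C T A; zero_mor C T B (f \<cdot> g)\<rbrakk> \<Longrightarrow> \<exists>u\<in>hom C T K. k \<cdot> u = g"
proof -
  have ty: "Src C f = A" "Tgt C f = B" using assms(2) by (simp_all add: hom_def)
  note k = assms(1)[unfolded is_kernel_def ty]
  show "k \<in> hom C K A" "zero_mor C K B (f \<cdot> k)" using k by simp_all
  show "\<exists>u\<in>hom C T K. k \<cdot> u = g" if "g \<in> hom C T A" "zero_mor C T B (f \<cdot> g)"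
    using k that by blast
qed

lemma kernel_mono:
  assumes "is_kernel C K k f" "f \<in> hom C A B" shows "mono C k"
proof (rule monoI)
  note k = kernelD[OF assms]
  show "k \<in> hom C K A" by (fact k)
  fix T g h assume gh: "g \<in> hom C T K" "h \<in> hom C T K" "k \<cdot> g = k \<cdot> h"
  have "f \<cdot> (k \<cdot> g) = (f \<cdot> k) \<cdot> g"
    using comp_assoc[OF gh(1) k(1) assms(2)] by simp
  then have "zero_mor C T B (f \<cdot> (k \<cdot> g))"
    using comp_zero_mor[OF k(2) gh(1)] by simp
  moreover have ty: "Src C f = A" "Tgt C f = B" using assms(2) by (simp_all add: hom_def)
  ultimately have "\<exists>!u. u \<in> hom C T K \<and> k \<cdot> u = k \<cdot> g"
    using assms(1)[unfolded is_kernel_def ty] comp[OF gh(1) k(1)] by blast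
  with gh(1,2) gh(3)[symmetric] show "g = h" by blast
qed

lemma cokernelD:
  assumes "is_cokernel C Q q f" "f \<in> hom C A B"
  shows "q \<in> hom C B Q" "zero_mor C A Q (q \<cdot> f)"
    "\<lbrakk>g \<in> hom C B T; zero_mor C A T (g \<cdot> f)\<rbrakk> \<Longrightarrow> \<exists>u\<in>hom C Q T. u \<cdot> q = g"
proof -
  have ty: "Src C f = A" "Tgt C f = B" using assms(2) by (simp_all add: hom_def)
  note q = assms(1)[unfolded is_cokernel_def ty]
  show "q \<in> hom C B Q" "zero_mor C A Q (q \<cdot> f)" using q by simp_all
  show "\<exists>u\<in>hom C Q T. u \<cdot> q = g" if "g \<in> hom C B T" "zero_mor C A T (g \<cdot> f)"
    using q that by blast
qed

end

context abelian_category
begin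

lemma mono_is_kernel:
  assumes "mono C f" "f \<in> hom C A B"
  obtains D g where "g \<in> hom C B D" "is_kernel C A f g"
proof -
  obtain g where g: "is_kernel C A f g"
    using mono_normal[OF assms(1)] assms(2) unfolding hom_def by blast
  then have "g \<in> hom C B (Tgt C g)"
    using assms(2) by (auto simp: is_kernel_def hom_def)
  with g show ?thesis using that by blast
qed

text \<open>A monomorphism is a kernel of some \<open>c\<close>, and \<open>c\<close> factors through the cokernel \<open>q\<close>; so whatever
  is killed by \<open>q\<close> is killed by \<open>c\<close>.\<close>
lemma mono_kernel_of_cokernel:
  assumes "mono C f" "f \<in> hom C A B" "is_cokernel C Q q f"
    and "g \<in> hom C T B" "zero_mor C T Q (q \<cdot> g)"
  shows "\<exists>u\<in>hom C T A. f \<cdot> u = g"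
proof -
  obtain D c where c: "c \<in> hom C B D" "is_kernel C A f c"
    using mono_is_kernel[OF assms(1,2)] .
  note q = cokernelD[OF assms(3,2)]
  obtain r where r: "r \<in> hom C Q D" "r \<cdot> q = c"
    using q(3)[OF c(1) kernelD(2)[OF c(2,1)]] by blast
  have "zero_mor C T D (c \<cdot> g)"
    using zero_mor_comp[OF assms(5) r(1)] comp_assoc[OF assms(4) q(1) r(1)] r(2) by simp
  then show ?thesis
    using kernelD(3)[OF c(2,1) assms(4)] by blast
qed

text \<open>If \<open>a\<close> is the kernel of \<open>c\<close>, then the pullback of \<open>a\<close> along any \<open>b\<close>, monomorphism or not, is the
  kernel of \<open>c b\<close>.\<close>
lemma intersection_exists:
  assumes "mono C a" "a \<in> hom C A Y" "b \<in> hom C B Y"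
  shows "\<exists>D j. is_intersection C D j a b"
proof -
  obtain E c where c: "c \<in> hom C Y E" "is_kernel C A a c"
    using mono_is_kernel[OF assms(1,2)] .
  have cb: "c \<cdot> b \<in> hom C B E" by (rule comp[OF assms(3) c(1)])
  then obtain D g where g: "is_kernel C D g (c \<cdot> b)"
    using has_kernels unfolding hom_def by blast
  note gD = kernelD[OF g cb]
  have "zero_mor C D E (c \<cdot> (b \<cdot> g))"
    using gD(2) comp_assoc[OF gD(1) assms(3) c(1)] by simp
  then obtain f where f: "f \<in> hom C D A" "a \<cdot> f = b \<cdot> g"
    using kernelD(3)[OF c(2,1) comp[OF gD(1) assms(3)]] by blast
  have "\<exists>!u. u \<in> hom C T D \<and> f \<cdot> u = s \<and> g \<cdot> u = t"
    if st: "s \<in> hom C T A" "t \<in> hom C T B" "a \<cdot> s = b \<cdot> t" for T s t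
  proof -
    have "(c \<cdot> b) \<cdot> t = (c \<cdot> a) \<cdot> s"
      using comp_assoc[OF st(2) assms(3) c(1)] comp_assoc[OF st(1) assms(2) c(1)] st(3) by simp
    then have "zero_mor C T E ((c \<cdot> b) \<cdot> t)"
      using comp_zero_mor[OF kernelD(2)[OF c(2,1)] st(1)] by simp
    then obtain u where u: "u \<in> hom C T D" "g \<cdot> u = t"
      using gD(3)[OF st(2)] by blast
    have "a \<cdot> (f \<cdot> u) = a \<cdot> s"
      using comp_assoc[OF u(1) f(1) assms(2)] comp_assoc[OF u(1) gD(1) assms(3)] f(2) u(2) st(3)
      by simp
    then have "f \<cdot> u = s"
      using monoD[OF assms(1,2) comp[OF u(1) f(1)] st(1)] by blast
    moreover have "v = u" if "v \<in> hom C T D" "g \<cdot> v = t" for v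
      using monoD[OF kernel_mono[OF g cb] gD(1) that(1) u(1)] that(2) u(2) by simp
    ultimately show ?thesis using u by blast
  qed
  moreover have "Src C a = A" "Src C b = B"
    using assms(2,3) by (auto simp: hom_def)
  ultimately have "is_intersection C D (a \<cdot> f) a b"
    unfolding is_intersection_def using f gD(1) hom_Ob(1)[OF f(1)] by blast
  then show ?thesis by blast
qed

text \<open>Without subtraction of morphisms, \<open>g t = h t\<close> is handled through the graphs \<open>u = (id, g)\<close> and
  \<open>v = (id, h)\<close>. As \<open>u\<close> is a split monomorphism, it is the kernel of some \<open>c\<close>, and \<open>c v\<close> vanishes on
  \<open>t\<close>, so it is zero; hence \<open>v\<close> factors through \<open>u\<close>, which forces \<open>v = u\<close>.\<close>
lemma epi_of_cokernel_zero:
  assumes t: "t \<in> hom C A S"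
    and zero: "\<And>E r. \<lbrakk>r \<in> hom C S E; zero_mor C A E (r \<cdot> t)\<rbrakk> \<Longrightarrow> zero_mor C S E r"
  shows "epi C t"
proof -
  have "g = h" if gh: "g \<in> hom C S E" "h \<in> hom C S E" "g \<cdot> t = h \<cdot> t" for E g h
  proof -
    obtain P p q where "is_product C S E P p q"
      using has_products[OF hom_Ob[OF gh(1)]] by blast
    then have P: "p \<in> hom C P S" "q \<in> hom C P E"
      and pair: "\<And>T f g. \<lbrakk>f \<in> hom C T S; g \<in> hom C T E\<rbrakk> \<Longrightarrow>
        \<exists>!u. u \<in> hom C T P \<and> p \<cdot> u = f \<and> q \<cdot> u = g"
      unfolding is_product_def by blast+
    have I: "\<i>\<d> S \<in> hom C S S" using ident hom_Ob[OF t] by blast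
    obtain u where u: "u \<in> hom C S P" "p \<cdot> u = \<i>\<d> S" "q \<cdot> u = g"
      using pair[OF I gh(1)] by blast
    obtain v where v: "v \<in> hom C S P" "p \<cdot> v = \<i>\<d> S" "q \<cdot> v = h"
      using pair[OF I gh(2)] by blast
    obtain D c where c: "c \<in> hom C P D" "is_kernel C S u c"
      using mono_is_kernel[OF split_mono[OF u(1) P(1) u(2)] u(1)] .
    have "p \<cdot> (v \<cdot> t) = p \<cdot> (u \<cdot> t)" "q \<cdot> (v \<cdot> t) = q \<cdot> (u \<cdot> t)"
      using comp_assoc[OF t u(1) P(1)] comp_assoc[OF t v(1) P(1)] comp_assoc[OF t u(1) P(2)]
        comp_assoc[OF t v(1) P(2)] u v gh(3) by simp_all
    then have vu: "v \<cdot> t = u \<cdot> t"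
      using pair[OF comp[OF comp[OF t u(1)] P(1)] comp[OF comp[OF t u(1)] P(2)]]
        comp[OF t u(1)] comp[OF t v(1)] by blast
    have "zero_mor C A D ((c \<cdot> v) \<cdot> t)"
      using comp_zero_mor[OF kernelD(2)[OF c(2,1)] t] comp_assoc[OF t u(1) c(1)]
        comp_assoc[OF t v(1) c(1)] vu by simp
    then have "zero_mor C S D (c \<cdot> v)"
      by (rule zero[OF comp[OF v(1) c(1)]])
    then obtain w where w: "w \<in> hom C S S" "u \<cdot> w = v"
      using kernelD(3)[OF c(2,1) v(1)] by blast
    have "w = \<i>\<d> S"
      using comp_assoc[OF w(1) u(1) P(1)] ident_comp[OF w(1)] w(2) u(2) v(2) by simp
    with w(2) comp_ident[OF u(1)] u(3) v(3) show "g = h" by simp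
  qed
  then show ?thesis
    using t by (auto simp: epi_def hom_def)
qed

text \<open>The image of \<open>t\<close>, that is the kernel \<open>m\<close> of its cokernel \<open>q\<close>, is a subobject of \<open>S\<close>. It is not zero,
  so it is all of \<open>S\<close>, and then \<open>q\<close> is zero.\<close>
lemma nonzero_into_simple_epi:
  assumes S: "simple_object C S" and t: "t \<in> hom C A S" and nonzero: "\<not> zero_mor C A S t"
  shows "epi C t"
proof (rule epi_of_cokernel_zero[OF t])
  obtain Q q where q: "is_cokernel C Q q t"
    using has_cokernels t unfolding hom_def by blast
  note qD = cokernelD[OF q t]
  obtain K m where m: "is_kernel C K m q"
    using has_kernels qD(1) unfolding hom_def by blast
  note mD = kernelD[OF m qD(1)]
  obtain x where x: "x \<in> hom C A K" "m \<cdot> x = t"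
    using mD(3)[OF t qD(2)] by blast
  have "\<not> zero_object C K"
    using nonzero x mD(1) by (auto simp: zero_mor_def)
  then obtain g where g: "g \<in> hom C S K" "m \<cdot> g = \<i>\<d> S"
    using S mD(1) kernel_mono[OF m qD(1)] unfolding simple_object_def inverse_pair_def by blast
  have "q = (q \<cdot> m) \<cdot> g"
    using comp_assoc[OF g(1) mD(1) qD(1)] g(2) comp_ident[OF qD(1)] by simp
  then have q0: "zero_mor C S Q q"
    using comp_zero_mor[OF mD(2) g(1)] by simp
  fix E r assume r: "r \<in> hom C S E" "zero_mor C A E (r \<cdot> t)"
  then obtain u where "u \<in> hom C Q E" "u \<cdot> q = r"
    using qD(3) by blast
  then show "zero_mor C S E r"
    using zero_mor_comp[OF q0] by blast
qed

lemma epi_zero: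
  assumes "epi C t" "t \<in> hom C A S" "r \<in> hom C S E" "zero_mor C A E (r \<cdot> t)"
  shows "zero_mor C S E r"
proof -
  obtain Z where Z: "zero_object C Z" using has_zero by blast
  obtain f where f: "f \<in> hom C S Z"
    using Z hom_Ob(1)[OF assms(3)] unfolding zero_object_def by blast
  obtain g where g: "g \<in> hom C Z E"
    using Z hom_Ob(2)[OF assms(3)] unfolding zero_object_def by blast
  have 0: "zero_mor C S E (g \<cdot> f)" "g \<cdot> f \<in> hom C S E"
    using Z f g comp[OF f g] unfolding zero_mor_def by blast+
  have "(g \<cdot> f) \<cdot> t = r \<cdot> t"
    by (rule zero_mor_unique[OF comp_zero_mor[OF 0(1) assms(2)] assms(4)])
  moreover have "Tgt C t = S" using assms(2) by (simp add: hom_def)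
  ultimately have "g \<cdot> f = r"
    using assms(1,3) 0(2) unfolding epi_def by blast
  with 0(1) show ?thesis by simp
qed

text \<open>An epimorphism is a cokernel of some \<open>d\<close>, and the hypothesis is applied to \<open>d\<close>.\<close>
lemma epi_factor:
  assumes "epi C t" "t \<in> hom C A S" "g \<in> hom C A E"
    and ker: "\<And>K x. \<lbrakk>x \<in> hom C K A; zero_mor C K S (t \<cdot> x)\<rbrakk> \<Longrightarrow> zero_mor C K E (g \<cdot> x)"
  shows "\<exists>r\<in>hom C S E. g = r \<cdot> t"
proof -
  obtain d where d: "is_cokernel C S t d"
    using epi_normal[OF assms(1)] assms(2) unfolding hom_def by blast
  then have d': "d \<in> hom C (Src C d) A"
    using assms(2) by (auto simp: is_cokernel_def hom_def)
  show ?thesis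
    using cokernelD(3)[OF d d' assms(3) ker[OF d' cokernelD(2)[OF d d']]] by blast
qed

end

section \<open>Chains of subobjects of an object of finite length\<close>

context abelian_category
begin

text \<open>For the filtration \<open>0 = Y 0 \<subseteq> \<dots> \<subseteq> Y n = X\<close> with simple quotients \<open>S k\<close> of \<open>Y (k + 1)\<close> by \<open>Y k\<close>, let
  \<open>J a\<close> be the set of those \<open>k\<close> for which \<open>a \<inter> Y (k + 1)\<close> has nonzero image in \<open>S k\<close>; the rank of \<open>a\<close> is
  the number of elements of \<open>J a\<close>. Clearly \<open>a \<subseteq> b\<close> implies \<open>J a \<subseteq> J b\<close>. If the two sets are equal, then
  \<open>b \<inter> Y k \<subseteq> a\<close> by induction on \<open>k\<close>, and \<open>b \<subseteq> a\<close> for \<open>k = n\<close>. In the step, if \<open>k\<close> is not in \<open>J b\<close>, then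
  \<open>b \<inter> Y (k + 1) \<subseteq> Y k\<close>. Otherwise the map from \<open>b \<inter> Y (k + 1)\<close> to the quotient of \<open>X\<close> by \<open>a\<close> kills
  \<open>b \<inter> Y k\<close>, so it factors through \<open>S k\<close>; there it vanishes on the image of \<open>a \<inter> Y (k + 1)\<close>, which is
  all of the simple object \<open>S k\<close>. The detour through \<open>S k\<close> replaces the subtraction of elements of
  \<open>a\<close> from elements of \<open>b\<close>, as addition of morphisms is not part of the structure.\<close>
lemma finite_length_strict_rank:
  assumes fl: "finite_length C X" and X: "X \<in> Ob C"
  shows "\<exists>\<rho> :: 'b \<Rightarrow> nat. \<forall>A B a b h. mono C a \<and> mono C b \<and> a \<in> hom C A X \<and> b \<in> hom C B X \<and>
    h \<in> hom C A B \<and> a = b \<cdot> h \<and> (\<forall>h'\<in>hom C B A. b \<noteq> a \<cdot> h') \<longrightarrow> \<rho> a < \<rho> b"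
proof -
  obtain n :: nat and Y u where Y0: "zero_object C (Y 0)" and Yn: "Y n = X"
    and u: "\<And>k. k < n \<Longrightarrow> u k \<in> hom C (Y k) (Y (Suc k)) \<and> mono C (u k)"
    and "\<And>k. k < n \<Longrightarrow> \<exists>S q. is_cokernel C S q (u k) \<and> simple_object C S"
    using fl unfolding finite_length_def by blast
  then obtain S q where q: "\<And>k. k < n \<Longrightarrow> is_cokernel C (S k) (q k) (u k) \<and> simple_object C (S k)"
    by metis
  \<comment> \<open>\<open>W k\<close> is the inclusion of \<open>Y k\<close> into \<open>X\<close>, composed of the steps \<open>u k, \<dots>, u (n - 1)\<close>; the
      recursion runs over the codimension \<open>n - k\<close>.\<close>
  define W where "W k = rec_nat (\<i>\<d> X) (\<lambda>i w. w \<cdot> u (n - Suc i)) (n - k)" for k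
  have Wn: "W n = \<i>\<d> X" by (simp add: W_def)
  have W_step: "W k = W (Suc k) \<cdot> u k" if "k < n" for k
  proof -
    have "n - k = Suc (n - Suc k)" "n - Suc (n - Suc k) = k" using that by simp_all
    then show ?thesis by (simp add: W_def)
  qed
  have W: "W k \<in> hom C (Y k) X" if "k \<le> n" for k
    using that
  proof (induction rule: inc_induct)
    case base
    show ?case using Wn Yn ident[OF X] by simp
  next
    case (step k)
    then show ?case using comp[OF conjunct1[OF u[of k]] step.IH] W_step[of k] by simp
  qed
  \<comment> \<open>The intersection \<open>a \<inter> Y (k + 1)\<close> is represented by its generalized elements: pairs \<open>s\<close>, \<open>z\<close> that
      agree in \<open>X\<close>.\<close>
  define J where "J a = {k. k < n \<and> (\<exists>T s z. s \<in> hom C T (Y (Suc k)) \<and> z \<in> hom C T (Src C a) \<and>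
    W (Suc k) \<cdot> s = a \<cdot> z \<and> \<not> zero_mor C T (S k) (q k \<cdot> s))}" for a
  have "card (J a) < card (J b)"
    if a: "mono C a" "a \<in> hom C A X" and b: "mono C b" "b \<in> hom C B X"
      and h: "h \<in> hom C A B" "a = b \<cdot> h" and ne: "\<And>h'. h' \<in> hom C B A \<Longrightarrow> b \<noteq> a \<cdot> h'"
    for A B a b h
  proof (rule psubset_card_mono)
    have src: "Src C a = A" "Src C b = B" using a b by (auto simp: hom_def)
    show "finite (J b)" by (simp add: J_def)
    show "J a \<subset> J b"
    proof
      show "J a \<subseteq> J b"
      proof
        fix k assume "k \<in> J a"
        then obtain T s z where k: "k < n" and s: "s \<in> hom C T (Y (Suc k))" "z \<in> hom C T A"
          "W (Suc k) \<cdot> s = a \<cdot> z" "\<not> zero_mor C T (S k) (q k \<cdot> s)"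
          unfolding J_def src by blast
        have "W (Suc k) \<cdot> s = b \<cdot> (h \<cdot> z)"
          using comp_assoc[OF s(2) h(1) b(2)] s(3) h(2) by simp
        with k s comp[OF s(2) h(1)] show "k \<in> J b"
          unfolding J_def src by blast
      qed
      show "J a \<noteq> J b"
      proof
        assume J: "J a = J b"
        obtain E c where c: "c \<in> hom C X E" "is_kernel C A a c"
          using mono_is_kernel[OF a] .
        have ca: "zero_mor C A E (c \<cdot> a)" by (rule kernelD(2)[OF c(2,1)])
        \<comment> \<open>As \<open>a\<close> is the kernel of \<open>c\<close>, containment in \<open>a\<close> is expressed as being killed by \<open>c\<close>.\<close>
        have claim: "k \<le> n \<Longrightarrow> s \<in> hom C T (Y k) \<Longrightarrow> z \<in> hom C T B \<Longrightarrow> W k \<cdot> s = b \<cdot> z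
          \<Longrightarrow> zero_mor C T E (c \<cdot> (W k \<cdot> s))" for k T s z
        proof (induction k arbitrary: T s z)
          case 0
          have "zero_mor C T E ((c \<cdot> W 0) \<cdot> s)"
            using Y0 0(2) comp[OF W[OF 0(1)] c(1)] unfolding zero_mor_def by blast
          then show ?case
            by (simp add: comp_assoc[OF 0(2) W[OF 0(1)] c(1)])
        next
          case (Suc k)
          have k: "k < n" "k \<le> n" using Suc.prems by auto
          note uk = u[OF k(1)] and qk = q[OF k(1)]
          note qkD = cokernelD[OF conjunct1[OF qk] conjunct1[OF uk]]
          note Wk = W[OF k(2)] and WSk = W[OF Suc.prems(1)]
          have low: "zero_mor C T E (c \<cdot> (W (Suc k) \<cdot> s))"
            if s: "s \<in> hom C T (Y (Suc k))" and z: "z \<in> hom C T B" "W (Suc k) \<cdot> s = b \<cdot> z"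
              and 0: "zero_mor C T (S k) (q k \<cdot> s)" for T s z
          proof -
            obtain y where y: "y \<in> hom C T (Y k)" "u k \<cdot> y = s"
              using mono_kernel_of_cokernel[of "u k" "Y k" "Y (Suc k)" "S k" "q k" s T] uk qk s 0
              by blast
            have "W (Suc k) \<cdot> s = W k \<cdot> y"
              using comp_assoc[OF y(1) conjunct1[OF uk] WSk] W_step[OF k(1)] y(2) by simp
            with Suc.IH[OF k(2) y(1) z(1)] z(2) show ?thesis by simp
          qed
          show ?case
          proof (cases "k \<in> J a")
            case False
            with J have "k \<notin> J b" by simp
            then have "zero_mor C T (S k) (q k \<cdot> s)"
              using Suc.prems k(1) unfolding J_def src by blast
            with low Suc.prems show ?thesis by blast
          next
            case True
            then obtain T' s' z' where s': "s' \<in> hom C T' (Y (Suc k))" "z' \<in> hom C T' A"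
              "W (Suc k) \<cdot> s' = a \<cdot> z'" "\<not> zero_mor C T' (S k) (q k \<cdot> s')"
              unfolding J_def src by blast
            obtain I j where Ij: "is_intersection C I j b (W (Suc k))"
              using intersection_exists[OF b WSk] by blast
            obtain f g where fg: "f \<in> hom C I B" "g \<in> hom C I (Y (Suc k))"
              "j = b \<cdot> f" "j = W (Suc k) \<cdot> g"
              and univ: "\<forall>T. \<forall>s\<in>hom C T B. \<forall>t\<in>hom C T (Y (Suc k)). b \<cdot> s = W (Suc k) \<cdot> t \<longrightarrow>
                (\<exists>!u. u \<in> hom C T I \<and> f \<cdot> u = s \<and> g \<cdot> u = t)"
              using is_intersectionE[OF Ij b(2) WSk] .
            \<comment> \<open>\<open>t\<close> is the map from \<open>b \<inter> Y (k + 1)\<close> to the simple layer, \<open>G\<close> the map to the quotient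
                by \<open>a\<close>.\<close>
            define t where "t = q k \<cdot> g"
            have t: "t \<in> hom C I (S k)" unfolding t_def by (rule comp[OF fg(2) qkD(1)])
            define G where "G = c \<cdot> (W (Suc k) \<cdot> g)"
            have G: "G \<in> hom C I E" unfolding G_def by (rule comp[OF comp[OF fg(2) WSk] c(1)])
            have G_comp: "G \<cdot> x = c \<cdot> (W (Suc k) \<cdot> (g \<cdot> x))" and t_comp: "t \<cdot> x = q k \<cdot> (g \<cdot> x)"
              if "x \<in> hom C K I" for K x
              using comp_assoc[OF that comp[OF fg(2) WSk] c(1)] comp_assoc[OF that fg(2) WSk]
                comp_assoc[OF that fg(2) qkD(1)] by (simp_all add: G_def t_def)
            have "b \<cdot> (h \<cdot> z') = W (Suc k) \<cdot> s'"
              using comp_assoc[OF s'(2) h(1) b(2)] s'(3) h(2) by simp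
            then obtain x' where x': "x' \<in> hom C T' I" "g \<cdot> x' = s'"
              using univ comp[OF s'(2) h(1)] s'(1) by blast
            have "\<not> zero_mor C I (S k) t"
              using comp_zero_mor[OF _ x'(1), of "S k" t] t_comp[OF x'(1)] x'(2) s'(4) by auto
            then have "epi C t"
              using nonzero_into_simple_epi[OF conjunct2[OF qk] t] by blast
            then have "\<exists>r\<in>hom C (S k) E. G = r \<cdot> t"
            proof (rule epi_factor[OF _ t G])
              fix K x assume x: "x \<in> hom C K I" "zero_mor C K (S k) (t \<cdot> x)"
              have "W (Suc k) \<cdot> (g \<cdot> x) = b \<cdot> (f \<cdot> x)"
                using comp_assoc[OF x(1) fg(2) WSk] comp_assoc[OF x(1) fg(1) b(2)] fg(3,4) by simp
              with low[OF comp[OF x(1) fg(2)] comp[OF x(1) fg(1)]] x(2)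
              show "zero_mor C K E (G \<cdot> x)"
                by (simp add: G_comp[OF x(1)] t_comp[OF x(1)])
            qed
            then obtain r where r: "r \<in> hom C (S k) E" "G = r \<cdot> t" by blast
            have "r \<cdot> (q k \<cdot> s') = c \<cdot> (a \<cdot> z')"
              using comp_assoc[OF x'(1) t r(1)] G_comp[OF x'(1)] t_comp[OF x'(1)] r(2) x'(2) s'(3)
              by simp
            moreover have "zero_mor C T' E (c \<cdot> (a \<cdot> z'))"
              using comp_zero_mor[OF ca s'(2)] comp_assoc[OF s'(2) a(2) c(1)] by simp
            moreover have "epi C (q k \<cdot> s')"
              using nonzero_into_simple_epi[OF conjunct2[OF qk] comp[OF s'(1) qkD(1)] s'(4)] .
            ultimately have "zero_mor C (S k) E r"
              using epi_zero[OF _ comp[OF s'(1) qkD(1)] r(1)] by simp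
            then have G0: "zero_mor C I E G"
              using comp_zero_mor[OF _ t] r(2) by simp
            obtain x where x: "x \<in> hom C T I" "g \<cdot> x = s"
              using univ Suc.prems(3,2) Suc.prems(4)[symmetric] by blast
            show ?thesis
              using comp_zero_mor[OF G0 x(1)] G_comp[OF x(1)] x(2) by simp
          qed
        qed
        have "zero_mor C B E (c \<cdot> b)"
          using claim[of n b B "\<i>\<d> B"] b(2) Yn Wn ident_comp[OF b(2)] comp_ident[OF b(2)]
            ident[OF hom_Ob(1)[OF b(2)]] by simp
        then show False
          using kernelD(3)[OF c(2,1) b(2)] ne by blast
      qed
    qed
  qed
  then show ?thesis
    by (intro exI[of _ "\<lambda>a. card (J a)"]) blast
qed

end

section \<open>Lattices of Frobenius subalgebras\<close>

text \<open>An upper bound of \<open>x\<close> and \<open>y\<close> of least rank is their join: its meet with any other upper bound is an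
  upper bound too, cannot have smaller rank, and is thus equal to it.\<close>
lemma lattice_of_ranked_meets:
  fixes L (structure) and \<rho> :: "'a \<Rightarrow> nat"
  assumes po: "partial_order L" and t: "t \<in> carrier L" "\<And>x. x \<in> carrier L \<Longrightarrow> x \<sqsubseteq> t"
    and meets: "\<And>x y. \<lbrakk>x \<in> carrier L; y \<in> carrier L\<rbrakk> \<Longrightarrow> \<exists>s. greatest L s (Lower L {x, y})"
    and rank: "\<And>x y. \<lbrakk>x \<in> carrier L; y \<in> carrier L; x \<sqsubseteq> y; x \<noteq> y\<rbrakk> \<Longrightarrow> \<rho> x < \<rho> y"
  shows "lattice L"
proof -
  interpret partial_order L by (rule po)
  show ?thesis
  proof unfold_locales
    fix x y assume xy: "x \<in> carrier L" "y \<in> carrier L"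
    show "\<exists>s. greatest L s (Lower L {x, y})" by (rule meets[OF xy])
    let ?U = "Upper L {x, y}"
    have U: "z \<in> ?U \<longleftrightarrow> z \<in> carrier L \<and> x \<sqsubseteq> z \<and> y \<sqsubseteq> z" for z
      using xy by (auto simp: Upper_def)
    have "t \<in> ?U" using t xy U by blast
    then obtain s where s: "s \<in> ?U" "\<And>z. z \<in> ?U \<Longrightarrow> \<rho> s \<le> \<rho> z"
      using ex_has_least_nat[of "\<lambda>z. z \<in> ?U" t \<rho>] by blast
    have "s \<sqsubseteq> z" if z: "z \<in> ?U" for z
    proof -
      have sz: "s \<in> carrier L" "z \<in> carrier L" using s(1) z U by blast+
      obtain w where w: "greatest L w (Lower L {s, z})" using meets[OF sz] by blast
      have wL: "w \<in> carrier L" "w \<sqsubseteq> s" "w \<sqsubseteq> z"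
        using w sz by (auto simp: greatest_def Lower_def)
      have "x \<sqsubseteq> w" "y \<sqsubseteq> w"
        using w sz s(1) z xy unfolding greatest_def Lower_def U by auto
      then have "\<rho> s \<le> \<rho> w" using s(2) wL(1) U by blast
      then have "w = s" using rank[OF wL(1) sz(1) wL(2)] by (meson leD)
      with wL(3) show ?thesis by simp
    qed
    with s(1) have "least L s ?U" by (auto simp: least_def U)
    then show "\<exists>s. least L s ?U" by blast
  qed
qed

lemma meet_eqI:
  assumes "partial_order L" "greatest L s (Lower L {x, y})"
  shows "meet L x y = s"
  unfolding meet_def inf_def
  by (rule some_equality[of "\<lambda>s. greatest L s (Lower L {x, y})"])
    (fact assms(2), rule partial_order.greatest_unique[OF assms(1) _ assms(2)])

locale ambient_abelian_frobenius_algebra = abelian_category C + ambient_frobenius_algebra C X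
  for C :: "('o, 'm, 'x) moncat_scheme" (structure) and X :: "('o, 'm) frob"
begin

text \<open>The universal property of the pullback, read in the order of classes.\<close>
lemma intersection_greatest:
  assumes L: "L \<subseteq> frob_classes C X" and \<alpha>: "\<alpha> \<in> L" "A \<in> \<alpha>" and \<beta>: "\<beta> \<in> L" "B \<in> \<beta>"
    and F: "F \<in> frob_subalgebras C X" "frob_intersection C (fob (fst F)) (snd F) A B"
      "frob_class C X F \<in> L"
  shows "greatest (frob_subposet C X L) (frob_class C X F) (Lower (frob_subposet C X L) {\<alpha>, \<beta>})"
proof -
  have cl: "\<gamma> \<in> frob_classes C X" if "\<gamma> \<in> L" for \<gamma> using L that by blast
  note A = frob_class_of_member(1)[OF cl[OF \<alpha>(1)] \<alpha>(2)]
  note B = frob_class_of_member(1)[OF cl[OF \<beta>(1)] \<beta>(2)]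
  have F': "F \<in> frob_class C X F" using F(1) by (simp add: frob_equiv_iff)
  note le = frob_le_class[OF cl cl]
  note I = intersection_sub_le[OF A B F(1,2)]
  have "frob_le C X \<gamma> (frob_class C X F)" if \<gamma>: "\<gamma> \<in> L" "frob_le C X \<gamma> \<alpha>" "frob_le C X \<gamma> \<beta>" for \<gamma>
  proof -
    obtain G where G: "G \<in> frob_subalgebras C X" "G \<in> \<gamma>"
      using frob_classesE[OF cl[OF \<gamma>(1)]] by blast
    have "sub_le G A" "sub_le G B"
      using \<gamma>(2,3) le[OF \<gamma>(1) \<alpha>(1) G(2) \<alpha>(2)] le[OF \<gamma>(1) \<beta>(1) G(2) \<beta>(2)] by blast+
    then show ?thesis
      using le[OF \<gamma>(1) F(3) G(2) F'] I(3)[OF G(1)] by blast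
  qed
  moreover have "frob_le C X (frob_class C X F) \<alpha>" "frob_le C X (frob_class C X F) \<beta>"
    using I(1,2) le[OF F(3) \<alpha>(1) F' \<alpha>(2)] le[OF F(3) \<beta>(1) F' \<beta>(2)] by blast+
  ultimately show ?thesis
    using F(3) \<alpha>(1) \<beta>(1) unfolding greatest_def Lower_def frob_subposet_def by auto
qed

lemma intersection_closure_classes:
  assumes "P \<subseteq> frob_classes C X"
  shows "intersection_closure C X P \<subseteq> frob_classes C X"
proof
  fix \<alpha> assume "\<alpha> \<in> intersection_closure C X P"
  then show "\<alpha> \<in> frob_classes C X"
    by induction (use assms frob_class_in_classes in blast)+
qed

text \<open>The closure need not have a top element; \<open>[X]\<close> provides one, so that any two classes have an
  upper bound. Intersections with \<open>[X]\<close> add no new classes.\<close>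
lemma intersection_closure_extends:
  assumes fl: "finite_length C (fob X)" and P: "P \<subseteq> frob_classes C X"
    and sd: "\<And>\<alpha> \<beta> A B D j. \<lbrakk>\<alpha> \<in> intersection_closure C X P; \<beta> \<in> intersection_closure C X P;
      A \<in> \<alpha>; B \<in> \<beta>; frob_intersection C D j A B\<rbrakk>
      \<Longrightarrow> ambiently_selfdual C (fob X) (fev C X) (fcoev C X) D j"
  shows "intersection_sublattice C X
    (insert (frob_class C X (X, \<i>\<d> (fob X))) (intersection_closure C X P))"
proof -
  define L where "L = insert (frob_class C X (X, \<i>\<d> (fob X))) (intersection_closure C X P)"
  define Q where "Q = frob_subposet C X L"
  have L: "L \<subseteq> frob_classes C X"
    using intersection_closure_classes[OF P] frob_class_in_classes[OF frob_subalgebra_self]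
    by (auto simp: L_def)
  have cl: "\<gamma> \<in> frob_classes C X" if "\<gamma> \<in> L" for \<gamma> using L that by blast
  have po: "partial_order Q" unfolding Q_def by (rule frob_subposet_partial_order[OF L])
  have carrier: "carrier Q = L" and leQ: "le Q = frob_le C X"
    by (simp_all add: Q_def frob_subposet_def)
  have le_top: "sub_le B A" if "A \<in> frob_class C X (X, \<i>\<d> (fob X))" "B \<in> frob_subalgebras C X" for A B
  proof -
    have A: "A \<in> frob_subalgebras C X" "proj (X, \<i>\<d> (fob X)) = proj A"
      using that(1) by (auto simp: frob_equiv_iff)
    have "sub_le B (X, \<i>\<d> (fob X))"
      unfolding sub_le_def fst_conv snd_conv
      using ident_comp[OF sub_hom[OF that(2)]] sub_hom[OF that(2)]
      by (intro bexI[of _ "snd B"]) (simp_all only:)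
    then have "proj A \<cdot> proj B = proj B"
      using sub_le_iff[OF that(2) frob_subalgebra_self] A(2) by simp
    then show ?thesis using sub_le_iff[OF that(2) A(1)] by blast
  qed
  have meets: "\<exists>F\<in>frob_subalgebras C X. frob_intersection C (fob (fst F)) (snd F) A B \<and>
      frob_class C X F \<in> L"
    if \<alpha>: "\<alpha> \<in> L" "A \<in> \<alpha>" and \<beta>: "\<beta> \<in> L" "B \<in> \<beta>" for \<alpha> \<beta> A B
  proof -
    note A = frob_class_of_member[OF cl[OF \<alpha>(1)] \<alpha>(2)]
    note B = frob_class_of_member[OF cl[OF \<beta>(1)] \<beta>(2)]
    consider "\<alpha> = frob_class C X (X, \<i>\<d> (fob X))" | "\<beta> = frob_class C X (X, \<i>\<d> (fob X))"
      | "\<alpha> \<in> intersection_closure C X P" "\<beta> \<in> intersection_closure C X P"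
      using \<alpha>(1) \<beta>(1) by (auto simp: L_def)
    then show ?thesis
    proof cases
      case 1
      then have "sub_le B A" using le_top \<alpha>(2) B(1) by blast
      then obtain h where "h \<in> hom C (fob (fst B)) (fob (fst A))" "snd B = snd A \<cdot> h"
        unfolding sub_le_def by blast
      then have "frob_intersection C (fob (fst B)) (snd B) A B"
        by (rule intersection_of_factor[OF sub_mono[OF A(1)] sub_hom[OF A(1)] sub_hom[OF B(1)]])
      with B \<beta>(1) show ?thesis by auto
    next
      case 2
      then have "sub_le A B" using le_top \<beta>(2) A(1) by blast
      then obtain h where "h \<in> hom C (fob (fst A)) (fob (fst B))" "snd A = snd B \<cdot> h"
        unfolding sub_le_def by blast
      then have "frob_intersection C (fob (fst A)) (snd A) B A"
        by (rule intersection_of_factor[OF sub_mono[OF B(1)] sub_hom[OF B(1)] sub_hom[OF A(1)]])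
      then have "frob_intersection C (fob (fst A)) (snd A) A B"
        by (rule intersection_commute[OF _ sub_hom[OF B(1)] sub_hom[OF A(1)]])
      with A \<alpha>(1) show ?thesis by auto
    next
      case 3
      obtain D j where I: "frob_intersection C D j A B"
        using intersection_exists[OF sub_mono[OF A(1)] sub_hom[OF A(1)] sub_hom[OF B(1)]] by blast
      obtain F where F: "F \<in> frob_subalgebras C X" "fob (fst F) = D" "snd F = j"
        using selfdual_intersection_frobenius[OF A(1) B(1) I sd[OF 3 \<alpha>(2) \<beta>(2) I]] .
      then have IF: "frob_intersection C (fob (fst F)) (snd F) A B" using I by simp
      have "frob_class C X F \<in> L"
        unfolding L_def by (rule insertI2, rule intersection_closure.step[OF 3 \<alpha>(2) \<beta>(2) F(1) IF])
      with F(1) IF show ?thesis by blast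
    qed
  qed
  obtain \<rho> :: "'m \<Rightarrow> nat" where \<rho>: "\<And>A B a b h. \<lbrakk>mono C a; mono C b; a \<in> hom C A (fob X);
      b \<in> hom C B (fob X); h \<in> hom C A B; a = b \<cdot> h; \<forall>h'\<in>hom C B A. b \<noteq> a \<cdot> h'\<rbrakk> \<Longrightarrow> \<rho> a < \<rho> b"
    using finite_length_strict_rank[OF fl fob] by blast
  define rep where "rep \<alpha> = (SOME A. A \<in> \<alpha>)" for \<alpha> :: "(('o, 'm) frob \<times> 'm) set"
  have rep: "rep \<alpha> \<in> \<alpha>" if "\<alpha> \<in> L" for \<alpha>
    using frob_classesE[OF cl[OF that]] someI[of "\<lambda>A. A \<in> \<alpha>"] unfolding rep_def by blast
  have "lattice Q"
  proof (rule lattice_of_ranked_meets[OF po, where \<rho> = "\<lambda>\<alpha>. \<rho> (snd (rep \<alpha>))"])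
    let ?t = "frob_class C X (X, \<i>\<d> (fob X))"
    show t: "?t \<in> carrier Q" by (simp add: carrier L_def)
    show "le Q \<alpha> ?t" if "\<alpha> \<in> carrier Q" for \<alpha>
    proof -
      note \<alpha> = that[unfolded carrier] and t = t[unfolded carrier]
      show ?thesis
        unfolding leQ using frob_le_class[OF cl[OF \<alpha>] cl[OF t] rep[OF \<alpha>] rep[OF t]]
          le_top[OF rep[OF t] frob_class_of_member(1)[OF cl[OF \<alpha>] rep[OF \<alpha>]]] by blast
    qed
    show "\<exists>s. greatest Q s (Lower Q {\<alpha>, \<beta>})" if "\<alpha> \<in> carrier Q" "\<beta> \<in> carrier Q" for \<alpha> \<beta>
    proof -
      note \<alpha> = that(1)[unfolded carrier] and \<beta> = that(2)[unfolded carrier]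
      show ?thesis
        using meets[OF \<alpha> rep[OF \<alpha>] \<beta> rep[OF \<beta>]]
          intersection_greatest[OF L \<alpha> rep[OF \<alpha>] \<beta> rep[OF \<beta>]] unfolding Q_def by blast
    qed
    show "\<rho> (snd (rep \<alpha>)) < \<rho> (snd (rep \<beta>))"
      if "\<alpha> \<in> carrier Q" "\<beta> \<in> carrier Q" "le Q \<alpha> \<beta>" "\<alpha> \<noteq> \<beta>" for \<alpha> \<beta>
    proof -
      note \<alpha> = that(1)[unfolded carrier] and \<beta> = that(2)[unfolded carrier]
      note A = frob_class_of_member[OF cl[OF \<alpha>] rep[OF \<alpha>]]
      note B = frob_class_of_member[OF cl[OF \<beta>] rep[OF \<beta>]]
      have le: "sub_le (rep \<alpha>) (rep \<beta>)"
        using that(3) frob_le_class[OF cl[OF \<alpha>] cl[OF \<beta>] rep[OF \<alpha>] rep[OF \<beta>]] unfolding leQ by blast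
      have nle: "\<not> sub_le (rep \<beta>) (rep \<alpha>)"
        using that(4) frob_class_eqI[OF A(1) B(1) le] A(2) B(2) by auto
      from le obtain h where h: "h \<in> hom C (fob (fst (rep \<alpha>))) (fob (fst (rep \<beta>)))"
        "snd (rep \<alpha>) = snd (rep \<beta>) \<cdot> h"
        unfolding sub_le_def by blast
      show ?thesis
        using \<rho>[OF sub_mono[OF A(1)] sub_mono[OF B(1)] sub_hom[OF A(1)] sub_hom[OF B(1)] h] nle
        unfolding sub_le_def by blast
    qed
  qed
  moreover have "\<exists>F\<in>frob_subalgebras C X. frob_intersection C (fob (fst F)) (snd F) A B \<and>
      meet Q \<alpha> \<beta> = frob_class C X F"
    if "\<alpha> \<in> L" "A \<in> \<alpha>" "\<beta> \<in> L" "B \<in> \<beta>" for \<alpha> \<beta> A B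
    using meets[OF that] meet_eqI[OF po] intersection_greatest[OF L that] unfolding Q_def by blast
  ultimately have "intersection_sublattice C X L"
    using L unfolding intersection_sublattice_def Q_def by blast
  then show ?thesis by (simp add: L_def)
qed

text \<open>Any two Frobenius subalgebras on the intersection of \<open>A\<close> and \<open>B\<close> contain each other and so have the
  same class, which is the meet of \<open>[A]\<close> and \<open>[B]\<close>.\<close>
lemma intersection_closure_subset_sublattice:
  assumes PL: "P \<subseteq> L" and L: "intersection_sublattice C X L"
  shows "intersection_closure C X P \<subseteq> L"
proof
  have L': "L \<subseteq> frob_classes C X" "lattice (frob_subposet C X L)"
    using L by (auto simp: intersection_sublattice_def)
  have cl: "\<gamma> \<in> frob_classes C X" if "\<gamma> \<in> L" for \<gamma> using L'(1) that by blast
  interpret Q: lattice "frob_subposet C X L" by (rule L'(2))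
  fix \<gamma> assume "\<gamma> \<in> intersection_closure C X P"
  then show "\<gamma> \<in> L"
  proof induction
    case (base \<alpha>)
    then show ?case using PL by blast
  next
    case (step \<alpha> \<beta> A B F)
    note A = frob_class_of_member(1)[OF cl[OF step.IH(1)] step.hyps(3)]
    note B = frob_class_of_member(1)[OF cl[OF step.IH(2)] step.hyps(4)]
    obtain G where G: "G \<in> frob_subalgebras C X" "frob_intersection C (fob (fst G)) (snd G) A B"
      "meet (frob_subposet C X L) \<alpha> \<beta> = frob_class C X G"
      using L step.IH step.hyps(3,4) unfolding intersection_sublattice_def by blast
    note F = step.hyps(5,6)
    note IF = intersection_sub_le[OF A B F] and IG = intersection_sub_le[OF A B G(1,2)]
    have "frob_class C X F = frob_class C X G"
      by (rule frob_class_eqI[OF F(1) G(1) IG(3)[OF F(1) IF(1,2)] IF(3)[OF G(1) IG(1,2)]])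
    moreover have "meet (frob_subposet C X L) \<alpha> \<beta> \<in> L"
      using Q.meet_closed[of \<alpha> \<beta>] step.IH by (simp add: frob_subposet_def)
    ultimately show ?case using G(3) by simp
  qed
qed

end

theorem theorem5p14:
  fixes C :: "('o, 'm) moncat" and X :: "('o, 'm) frob"
    and P :: "(('o, 'm) frob \<times> 'm) set set"
  assumes "abelian_rigid_monoidal_category C"
    and "frobenius_algebra C X"
    and "finite_length C (fob X)"
    and "P \<subseteq> frob_classes C X"
  shows "(\<exists>L. P \<subseteq> L \<and> intersection_sublattice C X L) \<longleftrightarrow>
    (\<forall>\<alpha>\<in>intersection_closure C X P. \<forall>\<beta>\<in>intersection_closure C X P. \<forall>A\<in>\<alpha>. \<forall>B\<in>\<beta>. \<forall>D j.
       frob_intersection C D j A B \<longrightarrow>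
       ambiently_selfdual C (fob X) (fev C X) (fcoev C X) D j)"
proof -
  interpret abelian_rigid_monoidal_category C by fact
  interpret frobenius_algebra C X by fact
  interpret ambient_abelian_frobenius_algebra C X ..
  show ?thesis
  proof
    assume "\<exists>L. P \<subseteq> L \<and> intersection_sublattice C X L"
    then obtain L where L: "P \<subseteq> L" "intersection_sublattice C X L" by blast
    note sub = intersection_closure_subset_sublattice[OF L]
    have cl: "L \<subseteq> frob_classes C X" using L(2) by (simp add: intersection_sublattice_def)
    show "\<forall>\<alpha>\<in>intersection_closure C X P. \<forall>\<beta>\<in>intersection_closure C X P. \<forall>A\<in>\<alpha>. \<forall>B\<in>\<beta>. \<forall>D j.
       frob_intersection C D j A B \<longrightarrow>
       ambiently_selfdual C (fob X) (fev C X) (fcoev C X) D j"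
    proof (intro ballI allI impI)
      fix \<alpha> \<beta> A B D j
      assume \<alpha>: "\<alpha> \<in> intersection_closure C X P" "A \<in> \<alpha>"
        and \<beta>: "\<beta> \<in> intersection_closure C X P" "B \<in> \<beta>" and I: "frob_intersection C D j A B"
      have ab: "\<alpha> \<in> L" "\<beta> \<in> L" using \<alpha>(1) \<beta>(1) sub by blast+
      obtain F where F: "F \<in> frob_subalgebras C X" "frob_intersection C (fob (fst F)) (snd F) A B"
        using L(2) ab \<alpha>(2) \<beta>(2) unfolding intersection_sublattice_def by blast
      have "A \<in> frob_subalgebras C X" "B \<in> frob_subalgebras C X"
        using ab cl \<alpha>(2) \<beta>(2) frob_class_of_member(1) by blast+
      then show "ambiently_selfdual C (fob X) (fev C X) (fcoev C X) D j"
        by (rule frobenius_intersection_selfdual[OF _ _ F I])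
    qed
  next
    assume sd: "\<forall>\<alpha>\<in>intersection_closure C X P. \<forall>\<beta>\<in>intersection_closure C X P. \<forall>A\<in>\<alpha>. \<forall>B\<in>\<beta>. \<forall>D j.
       frob_intersection C D j A B \<longrightarrow>
       ambiently_selfdual C (fob X) (fev C X) (fcoev C X) D j"
    have "intersection_sublattice C X
      (insert (frob_class C X (X, Ident C (fob X))) (intersection_closure C X P))"
      by (rule intersection_closure_extends[OF assms(3,4) sd[rule_format]])
    moreover have "P \<subseteq> insert (frob_class C X (X, Ident C (fob X))) (intersection_closure C X P)"
      by (auto intro: intersection_closure.base)
    ultimately show "\<exists>L. P \<subseteq> L \<and> intersection_sublattice C X L" by blast
  qed
qed

end
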